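(* Let $c=(c_n)_{n=-\infty}^\infty\subset\mathbb{H}$ be a non-trivial positive definite sequence with $c_0=1$, fix orthogonal $i,j\in\mathbb{S}$, and let $\mu_i$ be the $q$-positive measure on $\mathbb{T}_i$ with moment sequence $c$. If the Verblunsky coefficients $(\gamma_n)_{n=0}^\infty$ associated to $c$ are summable, i.e. if $$\sum_{n=0}^\infty|\gamma_n|<\infty,$$ then $\mu_i$ is absolutely continuous and the Radon–Nikodym derivative $w$ of $\mu_i$ extends uniquely to an element of the quaternionic Wiener algebra $\mathscr{W}_{\mathbb{H}}$.
   Context: $\mathbb{H}$ is the quaternions, $\mathbb{S}$ the sphere of purely imaginary unit quaternions (so $i^2=-1$ for $i\in\mathbb{S}$). For $i\in\mathbb{S}$: $\mathbb{C}_i=\mathbb{R}+\mathbb{R}i$, $\mathbb{T}_i$ is its unit circle. If $i,j\in\mathbb{S}$ are orthogonal (as vectors in $\mathbb{R}^3$), every quaternion is uniquely $p^{(1)}+p^{(2)}j$ with $p^{(1)},p^{(2)}\in\mathbb{C}_i$. A bi-infinite sequence $c=(c_n)_{n\in\mathbb{Z}}$ in $\mathbb{H}$ is positive definite if for every $n\ge0$ the Toeplitz matrix $T_n(c)=[c_{\ell-k}]_{k,\ell=0}^n$ (row $k$, column $\ell$) is positive semidefinite ($\xi^*T_n(c)\xi\ge0$ for all $\xi\in\mathbb{H}^{n+1}$), and is non-trivial if moreover every $T_n(c)$ is positive definite ($\xi^*T_n(c)\xi>0$ for all nonzero $\xi$). A quaternion-valued measure $\mu_i=\mu^{(1)}+\mu^{(2)}j$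 on $\mathbb{T}_i$ ($\mu^{(1)},\mu^{(2)}$ being $\mathbb{C}_i$-valued) is $q$-positive if $\mu^{(1)}$ is a positive measure, $\int_0^{2\pi} e^{in\theta}\mathrm{d}\mu^{(2)}(\theta)=-\int_0^{2\pi} e^{-in\theta}\mathrm{d}\mu^{(2)}(\theta)$ for all $n\in\mathbb{Z}$, and the measure $\begin{bmatrix}\mu^{(1)}&\mu^{(2)}\\ \overline{\mu^{(2)}}&\nu\end{bmatrix}$ is positive semidefinite-valued, where $\int_0^{2\pi} e^{in\theta}\mathrm{d}\nu(\theta)=\int_0^{2\pi} e^{-in\theta}\mathrm{d}\mu^{(1)}(\theta)$ for all $n\in\mathbb{Z}$. Its moments are $c_n=\int_0^{2\pi}e^{in\theta}\mathrm{d}\mu_i(\theta)$, $n\in\mathbb{Z}$. By the quaternionic Herglotz theorem (Alpay–Colombo–Kimsey–Sabadini), every positive definite $c$ is the moment sequence of a unique $q$-positive measure on $\mathbb{T}_i$. $\mu_i$ is absolutely continuous if there is $w\in L^1(\mathbb{T}_i;\mathbb{H})$ with $\mathrm{d}\mu_i(\theta)=w(e^{i\theta})\frac{\mathrm{d}\theta}{2\pi}$; $w$ is then its Radon–Nikodym derivative (determined a.e.). The quaternionic Wiener algebra $\mathscr{W}_{\mathbb{H}}$ is the set of functions $g(p)=\sum_{n=-\infty}^\infty p^na_n$ on $\partial\mathbb{B}=\{p\in\mathbb{H}:|p|=1\}$ with $a_n\in\mathbb{H}$ and $\sum_{n}|a_n|<\infty$. "Extends uniquely to an element of $\mathscr{W}_{\mathbb{H}}$"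 means there is exactly one $g\in\mathscr{W}_{\mathbb{H}}$ with $g|_{\mathbb{T}_i}=w$ (almost everywhere). Verblunsky coefficients. For power series with right coefficients the $\star$-product is $(\sum p^ka_k)\star(\sum p^kb_k)=\sum_np^n\sum_{k=0}^na_kb_{n-k}$, and $g^{-\star}$ is the $\star$-inverse. Let $F(p)=1+2\sum_{n\ge1}p^nc_{-n}$ for $|p|<1$ (so that $F(z)=\int_0^{2\pi}\frac{1+ze^{-i\theta}}{1-ze^{-i\theta}}\mathrm{d}\mu_i(\theta)$ for $z\in\mathbb{C}_i$, $|z|<1$), and let $f$ be the quaternionic Schur function with $F=(1+pf)\star(1-pf)^{-\star}$. The Verblunsky coefficients of $c$ are given by the quaternionic Schur algorithm: $f_0=f$, $\gamma_n=f_n(0)$, $p\,f_{n+1}(p)=(f_n-\gamma_n)\star(1-\overline{\gamma_n}\star f_n)^{-\star}(p)$; they satisfy $|\gamma_n|<1$. *)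

theory Defs
  imports
    "HOL-Analysis.Analysis"
    "HOL-Computational_Algebra.Formal_Power_Series"
begin

section \<open>Quaternions\<close>

codatatype quat = Quat (qRe: real) (qI: real) (qJ: real) (qK: real)

lemma quat_eq_iff: "x = y \<longleftrightarrow> qRe x = qRe y \<and> qI x = qI y \<and> qJ x = qJ y \<and> qK x = qK y"
  by (auto intro: quat.expand)

instantiation quat :: ab_group_add
begin

primcorec zero_quat where
  "qRe 0 = 0" | "qI 0 = 0" | "qJ 0 = 0" | "qK 0 = 0"

primcorec plus_quat where
  "qRe (x + y) = qRe x + qRe y"
| "qI (x + y) = qI x + qI y"
| "qJ (x + y) = qJ x + qJ y"
| "qK (x + y) = qK x + qK y"

primcorec uminus_quat where
  "qRe (- x) = - qRe x"
| "qI (- x) = - qI x"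
| "qJ (- x) = - qJ x"
| "qK (- x) = - qK x"

primcorec minus_quat where
  "qRe (x - y) = qRe x - qRe y"
| "qI (x - y) = qI x - qI y"
| "qJ (x - y) = qJ x - qJ y"
| "qK (x - y) = qK x - qK y"

instance
  by standard (simp_all add: quat_eq_iff)

end

instantiation quat :: ring_1
begin

primcorec one_quat where
  "qRe 1 = 1" | "qI 1 = 0" | "qJ 1 = 0" | "qK 1 = 0"

primcorec times_quat where
  "qRe (x * y) = qRe x * qRe y - qI x * qI y - qJ x * qJ y - qK x * qK y"
| "qI (x * y) = qRe x * qI y + qI x * qRe y + qJ x * qK y - qK x * qJ y"
| "qJ (x * y) = qRe x * qJ y - qI x * qK y + qJ x * qRe y + qK x * qI y"
| "qK (x * y) = qRe x * qK y + qI x * qJ y - qJ x * qI y + qK x * qRe y"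

instance
  by standard (simp_all add: quat_eq_iff algebra_simps)

end

instantiation quat :: real_algebra_1
begin

primcorec scaleR_quat where
  "qRe (r *\<^sub>R x) = r * qRe x"
| "qI (r *\<^sub>R x) = r * qI x"
| "qJ (r *\<^sub>R x) = r * qJ x"
| "qK (r *\<^sub>R x) = r * qK x"

instance
  by standard (simp_all add: quat_eq_iff algebra_simps)

end

primcorec qcnj :: "quat \<Rightarrow> quat" where
  "qRe (qcnj x) = qRe x"
| "qI (qcnj x) = - qI x"
| "qJ (qcnj x) = - qJ x"
| "qK (qcnj x) = - qK x"

instantiation quat :: real_inner
begin

definition inner_quat_def:
  "inner x y = qRe x * qRe y + qI x * qI y + qJ x * qJ y + qK x * qK y" for x y :: quat

definition norm_quat_def: "norm x = sqrt (inner x x)" for x :: quat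

definition sgn_quat_def: "sgn x = x /\<^sub>R norm x" for x :: quat

definition dist_quat_def: "dist x y = norm (x - y)" for x y :: quat

definition uniformity_quat_def [code del]:
  "(uniformity :: (quat \<times> quat) filter) = (INF e\<in>{0 <..}. principal {(x, y). dist x y < e})"

definition open_quat_def [code del]:
  "open (U :: quat set) \<longleftrightarrow> (\<forall>x\<in>U. eventually (\<lambda>(x', y). x' = x \<longrightarrow> y \<in> U) uniformity)"

instance
proof
  fix x y z :: quat and r :: real
  show "inner x x = 0 \<longleftrightarrow> x = 0"
  proof -
    have "a * a + b * b + c * c + d * d = 0 \<longleftrightarrow> a = 0 \<and> b = 0 \<and> c = 0 \<and> d = 0"
      for a b c d :: real
      by (simp add: add_nonneg_eq_0_iff)
    then show ?thesis
      by (simp add: inner_quat_def quat_eq_iff)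
  qed
qed (simp_all add: inner_quat_def norm_quat_def sgn_quat_def dist_quat_def uniformity_quat_def
      open_quat_def algebra_simps)

end

instantiation quat :: real_normed_div_algebra
begin

definition inverse_quat_def: "inverse x = qcnj x /\<^sub>R (norm x)\<^sup>2" for x :: quat

definition divide_quat_def: "x div y = x * inverse y" for x y :: quat

instance
proof
  fix x y :: quat
  have n2: "(norm x)\<^sup>2 = (qRe x)\<^sup>2 + (qI x)\<^sup>2 + (qJ x)\<^sup>2 + (qK x)\<^sup>2" for x :: quat
  proof -
    have "0 \<le> x \<bullet> x"
      by (rule inner_ge_zero)
    then show ?thesis
      by (simp add: norm_quat_def inner_quat_def power2_eq_square)
  qed
  have c: "qcnj x * x = (norm x)\<^sup>2 *\<^sub>R 1" "x * qcnj x = (norm x)\<^sup>2 *\<^sub>R 1" for x :: quat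
    unfolding n2 by (simp_all add: quat_eq_iff power2_eq_square mult.commute)
  show "x \<noteq> 0 \<Longrightarrow> inverse x * x = 1" "x \<noteq> 0 \<Longrightarrow> x * inverse x = 1"
    by (simp_all add: inverse_quat_def c)
  show "x div y = x * inverse y"
    by (rule divide_quat_def)
  show "inverse (0::quat) = 0"
    by (simp add: inverse_quat_def quat_eq_iff)
  have "(norm (x * y))\<^sup>2 = (norm x)\<^sup>2 * (norm y)\<^sup>2"
    unfolding n2 times_quat.simps by algebra
  then show "norm (x * y) = norm x * norm y"
    by (simp flip: power_mult_distrib)
qed

end

instantiation quat :: euclidean_space
begin

definition Basis_quat_def:
  "Basis = {Quat 1 0 0 0, Quat 0 1 0 0, Quat 0 0 1 0, Quat 0 0 0 1}"

instance
proof
  fix u v x :: quat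
  show "(Basis :: quat set) \<noteq> {}" "finite (Basis :: quat set)"
    by (simp_all add: Basis_quat_def)
  show "u \<in> Basis \<Longrightarrow> v \<in> Basis \<Longrightarrow> u \<bullet> v = (if u = v then 1 else 0)"
    unfolding Basis_quat_def inner_quat_def by (elim insertE emptyE; simp)
  show "(\<forall>u\<in>Basis. x \<bullet> u = 0) \<longleftrightarrow> x = 0"
    unfolding Basis_quat_def quat_eq_iff[of x 0] by (simp add: inner_quat_def)
qed

end

definition imag_units :: "quat set" where
  "imag_units = {i. qRe i = 0 \<and> norm i = 1}"

definition slice :: "quat \<Rightarrow> quat set" where
  "slice i = {of_real a + of_real b * i | a b. True}"

definition slice_circle :: "quat \<Rightarrow> quat set" where
  "slice_circle i = slice i \<inter> sphere 0 1"

definition qnonneg :: "quat \<Rightarrow> bool" where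
  "qnonneg q \<longleftrightarrow> q \<in> \<real> \<and> 0 \<le> qRe q"

definition qpos :: "quat \<Rightarrow> bool" where
  "qpos q \<longleftrightarrow> q \<in> \<real> \<and> 0 < qRe q"


section \<open>Positive definite sequences\<close>

text \<open>An $N \times N$ matrix is a function of two indices, of which only those below $N$ matter;
  vectors have their entries in \<open>K\<close>, which is all of \<^typ>\<open>quat\<close> or a slice.\<close>

definition quad_form :: "nat \<Rightarrow> (nat \<Rightarrow> nat \<Rightarrow> quat) \<Rightarrow> (nat \<Rightarrow> quat) \<Rightarrow> quat" where
  "quad_form N M \<xi> = (\<Sum>k<N. \<Sum>l<N. qcnj (\<xi> k) * M k l * \<xi> l)"

definition pos_semidef_on :: "quat set \<Rightarrow> nat \<Rightarrow> (nat \<Rightarrow> nat \<Rightarrow> quat) \<Rightarrow> bool" where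
  "pos_semidef_on K N M \<longleftrightarrow> (\<forall>\<xi>. (\<forall>k<N. \<xi> k \<in> K) \<longrightarrow> qnonneg (quad_form N M \<xi>))"

definition pos_def_on :: "quat set \<Rightarrow> nat \<Rightarrow> (nat \<Rightarrow> nat \<Rightarrow> quat) \<Rightarrow> bool" where
  "pos_def_on K N M \<longleftrightarrow>
     (\<forall>\<xi>. (\<forall>k<N. \<xi> k \<in> K) \<longrightarrow> (\<exists>k<N. \<xi> k \<noteq> 0) \<longrightarrow> qpos (quad_form N M \<xi>))"

definition toeplitz :: "(int \<Rightarrow> quat) \<Rightarrow> nat \<Rightarrow> nat \<Rightarrow> quat" where
  "toeplitz c k l = c (int l - int k)"

definition positive_definite_seq :: "(int \<Rightarrow> quat) \<Rightarrow> bool" where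
  "positive_definite_seq c \<longleftrightarrow> (\<forall>n. pos_semidef_on UNIV (n + 1) (toeplitz c))"

definition nontrivial_positive_definite_seq :: "(int \<Rightarrow> quat) \<Rightarrow> bool" where
  "nontrivial_positive_definite_seq c \<longleftrightarrow>
     positive_definite_seq c \<and> (\<forall>n. pos_def_on UNIV (n + 1) (toeplitz c))"


section \<open>Quaternion-valued measures\<close>

text \<open>Signed and quaternion-valued measures are countably additive set functions on the sets of a
  \<^typ>\<open>'a measure\<close> \<open>M\<close>, of which only the \<open>\<sigma>\<close>-algebra matters. Values outside \<open>sets M\<close> are
  irrelevant.\<close>

definition quat_measure :: "'a measure \<Rightarrow> ('a set \<Rightarrow> quat) \<Rightarrow> bool" where
  "quat_measure M \<mu> \<longleftrightarrow>
     (\<forall>A. range A \<subseteq> sets M \<longrightarrow> disjoint_family A \<longrightarrow> (\<lambda>n. \<mu> (A n)) sums \<mu> (\<Union>n::nat. A n))"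

text \<open>The positive part of the Jordan decomposition; the negative part is the positive part of
  the negated set function. The coercion \<^const>\<open>ennreal\<close> sends negative numbers to \<open>0\<close>, which is
  harmless since the empty set takes part in the supremum.\<close>

definition jordan_pos :: "'a measure \<Rightarrow> ('a set \<Rightarrow> real) \<Rightarrow> 'a measure" where
  "jordan_pos M \<nu> =
     measure_of (space M) (sets M) (\<lambda>A. SUP B\<in>{B \<in> sets M. B \<subseteq> A}. ennreal (\<nu> B))"

definition signed_integral :: "'a measure \<Rightarrow> ('a set \<Rightarrow> real) \<Rightarrow> ('a \<Rightarrow> quat) \<Rightarrow> quat" where
  "signed_integral M \<nu> f =
     (\<integral>x. f x \<partial>jordan_pos M \<nu>) - (\<integral>x. f x \<partial>jordan_pos M (\<lambda>A. - \<nu> A))"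

text \<open>The integral of \<open>f d\<mu>\<close> with the integrand to the left of the measure: the real components
  of \<open>\<mu>\<close> commute with the values of \<open>f\<close>, the basis quaternions stay on the right.\<close>

definition quat_integral :: "'a measure \<Rightarrow> ('a set \<Rightarrow> quat) \<Rightarrow> ('a \<Rightarrow> quat) \<Rightarrow> quat" where
  "quat_integral M \<mu> f = (\<Sum>e\<in>Basis. signed_integral M (\<lambda>A. \<mu> A \<bullet> e) f * e)"

definition circle_borel :: "quat \<Rightarrow> quat measure" where
  "circle_borel i = restrict_space borel (slice_circle i)"

text \<open>On the circle, \<open>e\<^sup>i\<^sup>n\<^sup>\<theta>\<close> is the function \<open>p \<mapsto> p\<^sup>n\<close>.\<close>

definition moment :: "quat \<Rightarrow> (quat set \<Rightarrow> quat) \<Rightarrow> int \<Rightarrow> quat" where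
  "moment i \<mu> n = quat_integral (circle_borel i) \<mu> (\<lambda>p. p powi n)"

text \<open>The set functions \<open>\<mu>1\<close>, \<open>\<mu>2\<close> and \<open>\<nu>\<close> are determined by \<open>\<mu>\<close>: the first two because
  \<open>1, j\<close> is a basis over the slice, the last one by its moments.\<close>

definition q_positive :: "quat \<Rightarrow> quat \<Rightarrow> (quat set \<Rightarrow> quat) \<Rightarrow> bool" where
  "q_positive i j \<mu> \<longleftrightarrow>
     quat_measure (circle_borel i) \<mu> \<and>
     (\<exists>\<mu>1 \<mu>2 \<nu>.
        (\<forall>A\<in>sets (circle_borel i).
           \<mu>1 A \<in> slice i \<and> \<mu>2 A \<in> slice i \<and> \<mu> A = \<mu>1 A + \<mu>2 A * j) \<and>
        (\<forall>A\<in>sets (circle_borel i). qnonneg (\<mu>1 A)) \<and>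
        (\<forall>n. moment i \<mu>2 n = - moment i \<mu>2 (- n)) \<and>
        quat_measure (circle_borel i) \<nu> \<and> (\<forall>A\<in>sets (circle_borel i). \<nu> A \<in> slice i) \<and>
        (\<forall>n. moment i \<nu> n = moment i \<mu>1 (- n)) \<and>
        (\<forall>A\<in>sets (circle_borel i).
           pos_semidef_on (slice i) 2
             (\<lambda>k l. if k = 0 then (if l = 0 then \<mu>1 A else \<mu>2 A)
                    else (if l = 0 then qcnj (\<mu>2 A) else \<nu> A))))"

definition arc_measure :: "quat \<Rightarrow> quat measure" where
  "arc_measure i =
     distr (uniform_measure lborel {0..<2 * pi}) (circle_borel i)
       (\<lambda>\<theta>. of_real (cos \<theta>) + of_real (sin \<theta>) * i)"

definition is_RN_derivative :: "quat \<Rightarrow> (quat set \<Rightarrow> quat) \<Rightarrow> (quat \<Rightarrow> quat) \<Rightarrow> bool" where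
  "is_RN_derivative i \<mu> w \<longleftrightarrow>
     integrable (arc_measure i) w \<and>
     (\<forall>A\<in>sets (circle_borel i). \<mu> A = (LINT p:A|arc_measure i. w p))"

definition abs_continuous :: "quat \<Rightarrow> (quat set \<Rightarrow> quat) \<Rightarrow> bool" where
  "abs_continuous i \<mu> \<longleftrightarrow> (\<exists>w. is_RN_derivative i \<mu> w)"

text \<open>Elements are functions on the unit sphere, hence \<^const>\<open>undefined\<close> elsewhere, so that
  equality in HOL is equality on the sphere.\<close>

definition wiener_algebra :: "(quat \<Rightarrow> quat) set" where
  "wiener_algebra =
     {(\<lambda>p\<in>sphere 0 1. \<Sum>\<^sub>\<infinity>n. p powi n * a n) | a :: int \<Rightarrow> quat.
        (\<lambda>n. norm (a n)) summable_on UNIV}"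


section \<open>Verblunsky coefficients\<close>

text \<open>A power series with right coefficients is identified with its coefficient sequence, an
  element of \<^typ>\<open>quat fps\<close>. The \<open>\<star>\<close>-product is then the product of \<^typ>\<open>quat fps\<close>, the
  \<open>\<star>\<close>-inverse is \<^const>\<open>inverse\<close>, and the variable \<open>p\<close> is \<^const>\<open>fps_X\<close>.\<close>

definition herglotz_series :: "(int \<Rightarrow> quat) \<Rightarrow> quat fps" where
  "herglotz_series c = Abs_fps (\<lambda>n. if n = 0 then 1 else 2 * c (- int n))"

definition schur_function :: "quat fps \<Rightarrow> bool" where
  "schur_function f \<longleftrightarrow>
     (\<forall>p. norm p < 1 \<longrightarrow>
        summable (\<lambda>n. p ^ n * fps_nth f n) \<and> norm (\<Sum>n. p ^ n * fps_nth f n) \<le> 1)"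

definition schur_function_of :: "(int \<Rightarrow> quat) \<Rightarrow> quat fps \<Rightarrow> bool" where
  "schur_function_of c f \<longleftrightarrow>
     schur_function f \<and>
     herglotz_series c = (1 + fps_X * f) * inverse (1 - fps_X * f)"

definition verblunsky_coeffs :: "(int \<Rightarrow> quat) \<Rightarrow> (nat \<Rightarrow> quat) \<Rightarrow> bool" where
  "verblunsky_coeffs c \<gamma> \<longleftrightarrow>
     (\<exists>f. schur_function_of c (f 0) \<and>
        (\<forall>n. \<gamma> n = fps_nth (f n) 0 \<and>
           fps_X * f (Suc n) =
             (f n - fps_const (\<gamma> n)) * inverse (1 - fps_const (qcnj (\<gamma> n)) * f n)))"

end

(* The measure w dtheta/(2 pi) with w = sum_n p^n a_n has n-th moment a_(-n), and a measure on the
   circle is determined by its moments, so the claim amounts to absolute summability of c.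

   Toeplitz positivity makes p f strictly contractive on truncated l^2, since for w = (1 - p f) v one
   has Re <F w, w> = |v|^2 - |p f v|^2; the Schur step preserves strict contractivity, whence
   |gamma_n| < 1. For large N the iterate f_N has small l^1 norm, being controlled by the tail of
   gamma. The step back from f_(n+1) to f_n preserves l^1 together with contractivity on l^2 by a
   constant below 1, because the inverse of 1 - g is in l^1 for such a contraction g in l^1. This Wiener
   lemma is reduced to real coefficients, where Newman's proof applies, by multiplying 1 - g with its
   conjugate. Finally F, the product of 1 + p f and the inverse of 1 - p f, is in l^1.

   Multiplication of power series is causal, so l^1 and l^2 norms of the coefficients up to a fixed
   index m can be estimated uniformly in m, and no convergence has to be discussed. *)

theory Submission
  imports Defs
begin

text \<open>Positivity of the finite Toeplitz matrices gives strict inequalities whose gap may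
  shrink with the truncation index, so the forward Schur algorithm yields nothing beyond
  coefficients of modulus below 1. A uniform gap first appears far out, where a small l^1 norm
  bounds the operator norm on l^2. Only finitely many backward steps lead from there to index 0, so
  it is harmless that each of them may narrow the gap. Noncommutativity shapes the rest. Newman's
  argument differentiates powers of an inverse and separates the powers of a product, which needs
  commuting coefficients. Coefficientwise conjugation reverses products, so a series times its
  conjugate is fixed by it and hence real; the price is an l^2 bound for the conjugate series,
  obtained by an adjoint argument. The backward Schur formula first comes out as a left quotient and
  has to be turned into a right quotient to suit left multiplication operators. Finally a moment has
  the form C + iS with quaternions C and S, which a single equation does not separate; the parity of
  cosine and sine in n does.\<close>

unbundle fps_syntax and no vec_syntax

section \<open>Truncated norms of power series\<close>

definition l1n :: "nat \<Rightarrow> 'a::real_normed_vector fps \<Rightarrow> real" where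
  "l1n m f = (\<Sum>k\<le>m. norm (f $ k))"

definition l2n :: "nat \<Rightarrow> 'a::real_normed_vector fps \<Rightarrow> real" where
  "l2n m f = L2_set (\<lambda>k. norm (f $ k)) {..m}"

text \<open>The least such \<open>C\<close> is the operator norm of left multiplication by
  \<open>f\<close> on l^2: causality makes the truncated inequalities equivalent to the full one. It
  stands in for the supremum norm on the disc.\<close>

definition l2_bounded :: "real \<Rightarrow> 'a::real_normed_algebra fps \<Rightarrow> bool" where
  "l2_bounded C f \<longleftrightarrow> (\<forall>m v. l2n m (f * v) \<le> C * l2n m v)"

definition l1_fps :: "'a::real_normed_vector fps \<Rightarrow> bool" where
  "l1_fps f \<longleftrightarrow> summable (\<lambda>n. norm (f $ n))"

lemma l1n_nonneg [simp]: "0 \<le> l1n m f"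
  by (simp add: l1n_def sum_nonneg)

lemma l2n_nonneg [simp]: "0 \<le> l2n m f"
  by (simp add: l2n_def)

lemma l2n_power2: "(l2n m f)\<^sup>2 = (\<Sum>k\<le>m. (norm (f $ k))\<^sup>2)"
  by (simp add: l2n_def L2_set_def sum_nonneg)

lemma l1n_add: "l1n m (f + g) \<le> l1n m f + l1n m g"
  by (simp add: l1n_def sum.distrib[symmetric] sum_mono norm_triangle_ineq)

lemma l1n_sum: "l1n m (\<Sum>i\<in>I. f i) \<le> (\<Sum>i\<in>I. l1n m (f i))"
proof (induction I rule: infinite_finite_induct)
  case (insert i I)
  then show ?case using l1n_add[of m "f i" "sum f I"] by simp
qed (simp_all add: l1n_def)

lemma l1n_uminus [simp]: "l1n m (- f) = l1n m f"
  by (simp add: l1n_def)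

lemma l2n_uminus [simp]: "l2n m (- f) = l2n m f"
  by (simp add: l2n_def)

lemma l2n_add: "l2n m (f + g) \<le> l2n m f + l2n m g"
proof -
  have "l2n m (f + g) \<le> L2_set (\<lambda>k. norm (f $ k) + norm (g $ k)) {..m}"
    unfolding l2n_def by (rule L2_set_mono) (simp_all add: norm_triangle_ineq)
  also have "\<dots> \<le> l2n m f + l2n m g"
    unfolding l2n_def by (rule L2_set_triangle_ineq)
  finally show ?thesis .
qed

lemma l2n_diff: "l2n m (f - g) \<le> l2n m f + l2n m g"
  using l2n_add[of m f "- g"] by simp

lemma l2n_le_l1n: "l2n m f \<le> l1n m f"
  by (simp add: l1n_def l2n_def L2_set_le_sum)

lemma norm_nth_le_l2n: "k \<le> m \<Longrightarrow> norm (f $ k) \<le> l2n m f"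
  unfolding l2n_def by (rule member_le_L2_set) auto

lemma l2n_one: "l2n m (1 :: 'a::real_normed_algebra_1 fps) = 1"
proof -
  have "(l2n m (1 :: 'a fps))\<^sup>2 = (\<Sum>k\<le>m. if k = 0 then 1 else 0)"
    unfolding l2n_power2 by (intro sum.cong) auto
  then show ?thesis using power2_eq_imp_eq[of "l2n m (1 :: 'a fps)" 1] by simp
qed

lemma l1n_const: "l1n m (fps_const a) = norm a"
proof -
  have "l1n m (fps_const a) = (\<Sum>k\<le>m. if k = 0 then norm a else 0)"
    unfolding l1n_def by (rule sum.cong) auto
  then show ?thesis by simp
qed

lemma l1n_one: "l1n m (1 :: 'a::real_normed_algebra_1 fps) = 1"
  using l1n_const[of m "1 :: 'a"] by simp

lemma sum_conv_le:
  fixes a b :: "nat \<Rightarrow> real"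
  assumes "\<And>k. 0 \<le> a k" "\<And>k. 0 \<le> b k"
  shows "(\<Sum>k\<le>m. \<Sum>i\<le>k. a i * b (k - i)) \<le> (\<Sum>k\<le>m. a k) * (\<Sum>k\<le>m. b k)"
proof -
  have "(\<Sum>k\<le>m. \<Sum>i\<le>k. a i * b (k - i)) = (\<Sum>(i, j)\<in>{(i, j). i + j \<le> m}. a i * b j)"
    by (simp add: sum.triangle_reindex_eq)
  also have "\<dots> \<le> (\<Sum>(i, j)\<in>{..m} \<times> {..m}. a i * b j)"
    by (rule sum_mono2) (auto simp: assms)
  finally show ?thesis by (simp add: sum_product sum.cartesian_product)
qed

lemma norm_fps_mult_nth:
  fixes f g :: "'a::real_normed_algebra fps"
  shows "norm ((f * g) $ k) \<le> (\<Sum>i\<le>k. norm (f $ i) * norm (g $ (k - i)))"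
  unfolding fps_mult_nth atLeast0AtMost
  by (rule order_trans[OF norm_sum]) (simp add: sum_mono norm_mult_ineq)

lemma l1n_mult:
  fixes f g :: "'a::real_normed_algebra fps"
  shows "l1n m (f * g) \<le> l1n m f * l1n m g"
proof -
  have "l1n m (f * g) \<le> (\<Sum>k\<le>m. \<Sum>i\<le>k. norm (f $ i) * norm (g $ (k - i)))"
    unfolding l1n_def by (intro sum_mono norm_fps_mult_nth)
  also have "\<dots> \<le> l1n m f * l1n m g"
    unfolding l1n_def by (rule sum_conv_le) auto
  finally show ?thesis .
qed

text \<open>Young's inequality for an l^1 and an l^2 sequence. Each weight |f_i| is split into two
  square roots, so that Cauchy-Schwarz leaves one factor \<open>l1n m f\<close> and the convolution
  of |f| with |g|^2, to which \<open>sum_conv_le\<close> applies.\<close>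

lemma l2n_mult:
  fixes f g :: "'a::real_normed_algebra fps"
  shows "l2n m (f * g) \<le> l1n m f * l2n m g"
proof (rule power2_le_imp_le)
  let ?a = "\<lambda>k. norm (f $ k)" and ?b = "\<lambda>k. norm (g $ k)"
  have "(l2n m (f * g))\<^sup>2 \<le> (\<Sum>k\<le>m. l1n m f * (\<Sum>i\<le>k. ?a i * (?b (k - i))\<^sup>2))"
    unfolding l2n_power2
  proof (rule sum_mono)
    fix k assume k: "k \<in> {..m}"
    have "(norm ((f * g) $ k))\<^sup>2 \<le> (\<Sum>i\<le>k. sqrt (?a i) * (sqrt (?a i) * ?b (k - i)))\<^sup>2"
      using norm_fps_mult_nth[of f g k] by (intro power_mono) (simp_all add: mult.assoc[symmetric])
    also have "\<dots> \<le> (\<Sum>i\<le>k. (sqrt (?a i))\<^sup>2) * (\<Sum>i\<le>k. (sqrt (?a i) * ?b (k - i))\<^sup>2)"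
      by (rule Cauchy_Schwarz_ineq_sum)
    also have "\<dots> \<le> l1n m f * (\<Sum>i\<le>k. ?a i * (?b (k - i))\<^sup>2)"
      unfolding l1n_def using k
      by (intro mult_mono sum_nonneg) (auto simp: power_mult_distrib intro!: sum_mono2)
    finally show "(norm ((f * g) $ k))\<^sup>2 \<le> l1n m f * (\<Sum>i\<le>k. ?a i * (?b (k - i))\<^sup>2)" .
  qed
  also have "\<dots> = l1n m f * (\<Sum>k\<le>m. \<Sum>i\<le>k. ?a i * (?b (k - i))\<^sup>2)"
    by (simp add: sum_distrib_left)
  also have "\<dots> \<le> l1n m f * (l1n m f * (l2n m g)\<^sup>2)"
    unfolding l2n_power2 by (intro mult_left_mono) (unfold l1n_def, intro sum_conv_le, auto simp: sum_nonneg)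
  finally show "(l2n m (f * g))\<^sup>2 \<le> (l1n m f * l2n m g)\<^sup>2"
    by (simp add: power2_eq_square algebra_simps)
qed (simp add: mult_nonneg_nonneg)

section \<open>Left multiplication operators on l^2\<close>

lemma l2_boundedD: "l2_bounded C f \<Longrightarrow> l2n m (f * v) \<le> C * l2n m v"
  by (simp add: l2_bounded_def)

lemma l2_bounded_nonneg: "l2_bounded C (f :: 'a::real_normed_algebra_1 fps) \<Longrightarrow> 0 \<le> C"
  using l2_boundedD[of C f 0 1] l2n_nonneg[of 0 f] by (simp add: l2n_one del: l2n_nonneg)

lemma l2_bounded_mono: "l2_bounded C f \<Longrightarrow> C \<le> D \<Longrightarrow> l2_bounded D f"
  unfolding l2_bounded_def by (meson l2n_nonneg mult_right_mono order_trans)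

lemma l2_bounded_l1: "(\<And>m. l1n m f \<le> C) \<Longrightarrow> l2_bounded C f"
  unfolding l2_bounded_def by (meson l2n_nonneg l2n_mult mult_right_mono order_trans)

lemma l2_bounded_mult:
  fixes f g :: "'a::real_normed_algebra_1 fps"
  assumes "l2_bounded C f" "l2_bounded D g"
  shows "l2_bounded (C * D) (f * g)"
  unfolding l2_bounded_def
proof (intro allI)
  fix m v
  have "l2n m (f * (g * v)) \<le> C * l2n m (g * v)"
    by (rule l2_boundedD[OF assms(1)])
  also have "\<dots> \<le> C * (D * l2n m v)"
    using l2_bounded_nonneg[OF assms(1)] l2_boundedD[OF assms(2)] by (intro mult_left_mono)
  finally show "l2n m (f * g * v) \<le> C * D * l2n m v" by (simp add: mult.assoc)
qed

lemma l2_bounded_power: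
  fixes f :: "'a::real_normed_algebra_1 fps"
  shows "l2_bounded C f \<Longrightarrow> l2_bounded (C ^ n) (f ^ n)"
  by (induction n) (simp_all add: l2_bounded_mult, simp add: l2_bounded_def)

text \<open>The test series 1 has norm 1 and returns the coefficients of \<open>f\<close>. At index
  0 this shows that \<open>1 - g\<close> has a nonzero constant term when \<open>g\<close> is
  bounded by a constant below 1.\<close>

lemma l2_bounded_nth:
  fixes f :: "'a::real_normed_algebra_1 fps"
  shows "l2_bounded C f \<Longrightarrow> norm (f $ k) \<le> C"
  using l2_boundedD[of C f k 1] norm_nth_le_l2n[of k k f] by (simp add: l2n_one)

lemma fps_divring_inverse:
  fixes f :: "'a::division_ring fps"
  assumes "f $ 0 \<noteq> 0"
  shows "inverse f * f = 1" "f * inverse f = 1"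
  using assms by (auto intro: inverse_mult_eq_1 inverse_mult_eq_1')

text \<open>The Neumann bound without the Neumann series: \<open>u = v + g * u\<close>, and the term
  \<open>\<rho> * l2n m u\<close> is absorbed into the left side, being finite because of the
  truncation.\<close>

lemma l2_bounded_inverse:
  fixes g :: "'a::real_normed_div_algebra fps"
  assumes "l2_bounded \<rho> g" "\<rho> < 1"
  shows "l2_bounded (1 / (1 - \<rho>)) (inverse (1 - g))"
  unfolding l2_bounded_def
proof (intro allI)
  fix m v
  define u where "u = inverse (1 - g) * v"
  have "(1 - g) $ 0 \<noteq> 0" using l2_bounded_nth[OF assms(1), of 0] assms(2) by auto
  then have "(1 - g) * u = v" by (simp add: u_def mult.assoc[symmetric] fps_divring_inverse)
  then have "u = v + g * u" by (simp add: algebra_simps)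
  then have "l2n m u \<le> l2n m v + l2n m (g * u)" using l2n_add by metis
  also have "\<dots> \<le> l2n m v + \<rho> * l2n m u" using l2_boundedD[OF assms(1)] by simp
  finally show "l2n m u \<le> 1 / (1 - \<rho>) * l2n m v" using assms(2) by (simp add: field_simps)
qed

section \<open>The algebra of absolutely summable series\<close>

lemma l1_fps_iff_bounded: "l1_fps f \<longleftrightarrow> (\<exists>K. \<forall>m. l1n m f \<le> K)"
proof
  assume "l1_fps f"
  then show "\<exists>K. \<forall>m. l1n m f \<le> K"
    unfolding l1_fps_def l1n_def by (intro exI[of _ "\<Sum>n. norm (f $ n)"]) (auto intro: sum_le_suminf)
next
  assume "\<exists>K. \<forall>m. l1n m f \<le> K"
  then obtain K where "\<And>m. l1n m f \<le> K" by blast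
  then show "l1_fps f"
    unfolding l1_fps_def l1n_def by (intro bounded_imp_summable[of _ K]) auto
qed

lemma l1_fps_mult:
  fixes f g :: "'a::real_normed_algebra fps"
  assumes "l1_fps f" "l1_fps g"
  shows "l1_fps (f * g)"
proof -
  obtain K L where "\<And>m. l1n m f \<le> K" "\<And>m. l1n m g \<le> L"
    using assms unfolding l1_fps_iff_bounded by blast
  then have "l1n m (f * g) \<le> K * L" for m
    by (meson l1n_mult l1n_nonneg mult_mono order_trans)
  then show ?thesis unfolding l1_fps_iff_bounded by blast
qed

lemma l1_fps_add: "l1_fps f \<Longrightarrow> l1_fps g \<Longrightarrow> l1_fps (f + g)"
  unfolding l1_fps_def
  by (rule summable_comparison_test'[OF summable_add, of "\<lambda>n. norm (f $ n)" "\<lambda>n. norm (g $ n)" 0])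
    (auto simp: norm_triangle_ineq)

lemma l1_fps_uminus: "l1_fps f \<Longrightarrow> l1_fps (- f)"
  by (simp add: l1_fps_def)

lemma l1_fps_const: "l1_fps (fps_const a)"
  unfolding l1_fps_def by (rule summable_finite[of "{0}"]) auto

lemma l1_fps_one: "l1_fps (1 :: 'a::real_normed_algebra_1 fps)"
  using l1_fps_const[of 1] by simp

lemma l1_fps_X: "l1_fps (fps_X :: 'a::real_normed_algebra_1 fps)"
  unfolding l1_fps_def by (rule summable_finite[of "{1}"]) auto

section \<open>A Wiener lemma\<close>

text \<open>The induction carries the sharper bound 2 - 1/m, which telescopes.\<close>

lemma sum_inverse_squares_le: "(\<Sum>k=1..m. (1 / real k)\<^sup>2) \<le> 2"
proof -
  have "(\<Sum>k=1..m. (1 / real k)\<^sup>2) \<le> 2 - 1 / real m" if "m \<ge> 1" using that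
  proof (induction m rule: dec_induct)
    case (step n)
    have "(1 / real (Suc n))\<^sup>2 \<le> 1 / real n - 1 / real (Suc n)"
    proof -
      have "(1 / real (Suc n))\<^sup>2 \<le> 1 / (real n * real (Suc n))"
        using step by (simp add: power2_eq_square divide_simps)
      also have "\<dots> = 1 / real n - 1 / real (Suc n)"
        using step by (simp add: divide_simps)
      finally show ?thesis .
    qed
    then show ?case using step.IH by simp
  qed simp
  then show ?thesis by (cases "m = 0") (auto intro: order_trans)
qed

text \<open>Cauchy-Schwarz against the square summable sequence 1/k. The factor \<open>fps_X\<close>
  undoes the index shift of the derivative, so that both sides are truncated at the same
  index.\<close>

lemma l1n_le_deriv:
  fixes h :: "real fps"
  shows "l1n m h \<le> \<bar>h $ 0\<bar> + 2 * l2n m (fps_X * fps_deriv h)"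
proof -
  have D: "(fps_X * fps_deriv h) $ k = real k * h $ k" for k
    by (cases k) simp_all
  have "(\<Sum>k=1..m. \<bar>h $ k\<bar>) = (\<Sum>k=1..m. \<bar>1 / real k\<bar> * \<bar>real k * h $ k\<bar>)"
    by (rule sum.cong) (auto simp: abs_mult)
  also have "\<dots> \<le> L2_set (\<lambda>k. 1 / real k) {1..m} * L2_set (\<lambda>k. real k * h $ k) {1..m}"
    by (rule L2_set_mult_ineq)
  also have "\<dots> \<le> 2 * l2n m (fps_X * fps_deriv h)"
  proof (rule mult_mono)
    show "L2_set (\<lambda>k. 1 / real k) {1..m} \<le> 2"
      unfolding L2_set_def using sum_inverse_squares_le[of m] by (intro real_le_lsqrt) auto
    show "L2_set (\<lambda>k. real k * h $ k) {1..m} \<le> l2n m (fps_X * fps_deriv h)"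
      unfolding l2n_def L2_set_def D by (auto intro!: sum_mono2)
  qed auto
  finally show ?thesis
    unfolding l1n_def by (simp add: atMost_atLeast0 sum.atLeast_Suc_atMost)
qed

lemma sum_half_powers: "(\<Sum>k<K. (1/2) ^ k) \<le> (2::real)"
  by (simp add: sum_gp_strict)

lemma sum_half_powers': "(\<Sum>k<K. real (k + 1) * (1/2) ^ k) \<le> 4"
proof -
  have "(\<Sum>k<K. real (k + 1) * (1/2) ^ k) = 4 - (2 * real K + 4) * (1/2) ^ K"
  proof (induction K)
    case (Suc K)
    show ?case unfolding sum.lessThan_Suc Suc by (simp add: algebra_simps)
  qed simp
  then show ?thesis by simp
qed

text \<open>Newman's proof of Wiener's lemma: \<open>b\<close> is split into a polynomial \<open>P\<close> and a small
  remainder \<open>r\<close>, and \<open>1/b = \<Sum> (-r)\<^sup>k / P\<^sup>k\<^sup>+\<^sup>1\<close>, where the powers of \<open>1/P\<close> are estimated in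
  \<open>\<ell>\<^sup>1\<close> by the \<open>\<ell>\<^sup>2\<close> norm of their derivatives.\<close>

lemma wiener_real:
  fixes b :: "real fps"
  assumes b: "l1_fps b" and b0: "b $ 0 \<noteq> 0" and inv: "l2_bounded C (inverse b)"
  shows "l1_fps (inverse b)"
proof -
  have "\<bar>inverse (b $ 0)\<bar> \<le> C" using l2_bounded_nth[OF inv, of 0] by simp
  moreover have "\<bar>inverse (b $ 0)\<bar> > 0" using b0 by simp
  ultimately have C: "C > 0" by linarith
  \<comment> \<open>A remainder of l^1 norm at most \<open>E\<close> makes
    \<open>inverse b * r\<close> a contraction by C E = 1/3, so the inverse of \<open>P\<close> is
    bounded by C / (1 - 1/3), which is \<open>C'\<close>. The product \<open>E * C' = 1 / 2\<close>
    is the ratio of the final geometric series.\<close>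
  define E where "E = 1 / (3 * C)"
  define C' where "C' = 3 / 2 * C"
  have E: "E > 0" "E * C' = 1 / 2" "C' > 0" using C by (auto simp: E_def C'_def field_simps)
  obtain N0 where N0: "\<And>n. n \<ge> N0 \<Longrightarrow> norm (\<Sum>k. norm (b $ (k + n))) < E"
    using suminf_exist_split[OF E(1) b[unfolded l1_fps_def]] by auto
  \<comment> \<open>The successor makes \<open>N\<close> positive, so the constant term of
    \<open>b\<close> goes to \<open>P\<close>, which is therefore invertible, and \<open>r\<close>
    has none.\<close>
  define N where "N = Suc N0"
  define P where "P = fps_cutoff N b"
  define r where "r = b - P"
  define Q where "Q = inverse P"
  have r_l1: "l1n m r \<le> E" for m
  proof -
    have s: "summable (\<lambda>k. norm (b $ (k + N)))"
      using b unfolding l1_fps_def by (rule summable_ignore_initial_segment)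
    have "l1n m r \<le> l1n (m + N) r" unfolding l1n_def by (rule sum_mono2) auto
    also have "\<dots> = (\<Sum>k\<in>{N..m+N}. norm (b $ k))"
      unfolding l1n_def by (rule sum.mono_neutral_cong_right) (auto simp: r_def P_def)
    also have "\<dots> = (\<Sum>k\<le>m. norm (b $ (k + N)))"
      using sum.shift_bounds_cl_nat_ivl[of "\<lambda>k. norm (b $ k)" 0 N m] by (simp add: atMost_atLeast0)
    also have "\<dots> \<le> (\<Sum>k. norm (b $ (k + N)))" by (rule sum_le_suminf[OF s]) auto
    also have "\<dots> \<le> E" using N0[of N] by (simp add: N_def)
    finally show ?thesis .
  qed
  have b_inv: "inverse b * b = 1" using b0 by (simp add: inverse_mult_eq_1)
  have P0: "P $ 0 \<noteq> 0" using b0 by (simp add: P_def N_def)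
  have QP: "Q * P = 1" using P0 by (simp add: Q_def inverse_mult_eq_1)
  have r0: "r $ 0 = 0" by (simp add: r_def P_def N_def)
  have "l2_bounded (C * E) (inverse b * r)"
    by (intro l2_bounded_mult inv l2_bounded_l1 r_l1)
  then have "l2_bounded (1 / (1 - 1/3)) (inverse (1 - inverse b * r))"
    using C by (intro l2_bounded_inverse) (simp_all add: E_def)
  then have "l2_bounded (C * (1 / (1 - 1/3))) (inverse b * inverse (1 - inverse b * r))"
    by (rule l2_bounded_mult[OF inv])
  moreover have "inverse b * inverse (1 - inverse b * r) = Q"
  proof -
    have "P = b * (1 - inverse b * r)"
      using b_inv by (simp add: algebra_simps r_def)
    then show ?thesis by (simp add: Q_def fps_inverse_mult)
  qed
  ultimately have Q_l2: "l2_bounded C' Q" by (simp add: C'_def mult.commute)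
  \<comment> \<open>The cost of differentiating the polynomial \<open>P\<close>. It depends on
    \<open>N\<close>, but neither on the truncation index nor on the power of
    \<open>Q\<close>.\<close>
  define M where "M = (\<Sum>k<N. real k * \<bar>b $ k\<bar>)"
  have DP: "l2n m (fps_X * fps_deriv P) \<le> M" for m
  proof -
    have "l2n m (fps_X * fps_deriv P) \<le> l1n m (fps_X * fps_deriv P)" by (rule l2n_le_l1n)
    also have "\<dots> = (\<Sum>k\<le>m. if k < N then real k * \<bar>b $ k\<bar> else 0)"
      unfolding l1n_def
    proof (rule sum.cong)
      fix k show "norm ((fps_X * fps_deriv P) $ k) = (if k < N then real k * \<bar>b $ k\<bar> else 0)"
        by (cases k) (auto simp: P_def abs_mult)
    qed simp
    also have "\<dots> = (\<Sum>k\<in>{..m} \<inter> {..<N}. real k * \<bar>b $ k\<bar>)"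
      by (rule sum.mono_neutral_cong_right) auto
    also have "\<dots> \<le> M" unfolding M_def by (rule sum_mono2) auto
    finally show ?thesis .
  qed
  have M0: "M \<ge> 0" by (simp add: M_def sum_nonneg)
  have Qn: "l1n m (Q ^ n) \<le> C' ^ n + 2 * real n * C' ^ (n + 1) * M" for m n
  proof -
    have bd: "\<bar>(Q ^ n) $ 0\<bar> \<le> C' ^ n"
      using l2_bounded_nth[OF l2_bounded_power[OF Q_l2, of n], of 0] by simp
    \<comment> \<open>The derivative of \<open>P\<close> occurs only once, so the powers of
      \<open>Q\<close> enter as operators on l^2 of norm at most \<open>C' ^ (n + 1)\<close> and no
      l^1 norm of \<open>Q\<close> is used. The resulting growth is linear times geometric with
      ratio \<open>C'\<close>.\<close>
    have "fps_deriv (Q ^ n) = - of_nat n * (Q ^ (n + 1) * fps_deriv P)"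
    proof (induction n)
      case (Suc n)
      have "fps_deriv Q = - fps_deriv P * Q\<^sup>2"
        unfolding Q_def by (rule fps_inverse_deriv[OF P0])
      then show ?case
        by (simp add: Suc power2_eq_square algebra_simps)
    qed simp
    then have "fps_X * fps_deriv (Q ^ n) = - (fps_const (real n) * (Q ^ (n + 1) * (fps_X * fps_deriv P)))"
      by (simp add: fps_of_nat algebra_simps)
    then have "l2n m (fps_X * fps_deriv (Q ^ n)) = real n * l2n m (Q ^ (n + 1) * (fps_X * fps_deriv P))"
      by (simp add: l2n_def abs_mult L2_set_right_distrib)
    also have "\<dots> \<le> real n * (C' ^ (n + 1) * l2n m (fps_X * fps_deriv P))"
      by (intro mult_left_mono l2_boundedD l2_bounded_power Q_l2) auto
    also have "\<dots> \<le> real n * (C' ^ (n + 1) * M)"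
      using E by (intro mult_left_mono DP) auto
    finally show ?thesis using l1n_le_deriv[of m "Q ^ n"] bd by simp
  qed
  have "l1n m (inverse b) \<le> C' * (2 + 8 * C' * M)" for m
  proof -
    define s where "s = - r * Q"
    \<comment> \<open>Since \<open>s\<close> has no constant term, \<open>s ^ K\<close> has no
      coefficients up to index \<open>m\<close>; the finite geometric sum is exact there and its
      remainder vanishes under truncation.\<close>
    define K where "K = Suc m"
    have bQ: "b * Q = 1 - s" using QP by (simp add: s_def r_def algebra_simps)
    have "1 - s ^ K = (1 - s) * (\<Sum>k<K. s ^ k)"
      by (rule one_diff_power_eq)
    then have "(inverse b * b) * Q * (\<Sum>k<K. s ^ k) = inverse b * (1 - s ^ K)"
      using bQ by (simp add: mult.assoc)
    then have "inverse b = (\<Sum>k<K. Q * s ^ k) + s ^ K * inverse b"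
      unfolding b_inv by (simp add: sum_distrib_left algebra_simps)
    moreover have "Q * s ^ k = (- r) ^ k * Q ^ (k + 1)" for k
      unfolding s_def power_mult_distrib by simp
    ultimately have ib: "inverse b = (\<Sum>k<K. (- r) ^ k * Q ^ (k + 1)) + s ^ K * inverse b"
      by simp
    have "l1n m (s ^ K * inverse b) = 0"
    proof -
      have "s $ 0 = 0" using r0 by (simp add: s_def)
      then have "(s ^ K * inverse b) $ k = 0" if "k \<le> m" for k
        using that startsby_zero_power_prefix[of s K]
        by (auto simp: fps_mult_nth K_def intro!: sum.neutral)
      then show ?thesis by (simp add: l1n_def)
    qed
    then have "l1n m (inverse b) \<le> l1n m (\<Sum>k<K. (- r) ^ k * Q ^ (k + 1))"
      using l1n_add[of m "\<Sum>k<K. (- r) ^ k * Q ^ (k + 1)" "s ^ K * inverse b"] ib by simp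
    also have "\<dots> \<le> (\<Sum>k<K. l1n m ((- r) ^ k * Q ^ (k + 1)))" by (rule l1n_sum)
    also have "\<dots> \<le> (\<Sum>k<K. C' * (1/2) ^ k + 2 * C'\<^sup>2 * M * (real (k + 1) * (1/2) ^ k))"
    proof (rule sum_mono)
      fix k
      have "l1n m ((- r) ^ k) \<le> E ^ k"
      proof (induction k)
        case 0
        show ?case by (simp add: l1n_one)
      next
        case (Suc k)
        have "l1n m ((- r) * (- r) ^ k) \<le> l1n m (- r) * l1n m ((- r) ^ k)" by (rule l1n_mult)
        also have "\<dots> \<le> E * E ^ k" using Suc r_l1[of m] E(1) by (intro mult_mono) auto
        finally show ?case by simp
      qed
      then have "l1n m ((- r) ^ k * Q ^ (k + 1)) \<le> E ^ k * (C' ^ (k + 1) + 2 * real (k + 1) * C' ^ (k + 1 + 1) * M)"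
        by (intro order_trans[OF l1n_mult] mult_mono Qn) (use E(1) in auto)
      also have "\<dots> = C' * (E * C') ^ k + 2 * C'\<^sup>2 * M * (real (k + 1) * (E * C') ^ k)"
        by (simp add: algebra_simps power2_eq_square power_mult_distrib)
      finally show "l1n m ((- r) ^ k * Q ^ (k + 1)) \<le> C' * (1/2) ^ k + 2 * C'\<^sup>2 * M * (real (k + 1) * (1/2) ^ k)"
        unfolding E(2) .
    qed
    also have "\<dots> = C' * (\<Sum>k<K. (1/2) ^ k) + 2 * C'\<^sup>2 * M * (\<Sum>k<K. real (k + 1) * (1/2) ^ k)"
      by (simp add: sum.distrib sum_distrib_left del: of_nat_Suc of_nat_add)
    also have "\<dots> \<le> C' * 2 + 2 * C'\<^sup>2 * M * 4"
      using E(3) M0 sum_half_powers[of K] sum_half_powers'[of K]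
      by (intro add_mono mult_left_mono) auto
    finally show ?thesis by (simp add: algebra_simps power2_eq_square)
  qed
  then show ?thesis unfolding l1_fps_iff_bounded by blast
qed

section \<open>Quaternionic power series\<close>

lemma qcnj_simps [simp]:
  "qcnj 0 = 0" "qcnj 1 = 1" "qcnj (qcnj x) = x" "qcnj (- x) = - qcnj x"
  "qcnj (x + y) = qcnj x + qcnj y" "qcnj (x - y) = qcnj x - qcnj y"
  "qcnj (x * y) = qcnj y * qcnj x"
  by (simp_all add: quat_eq_iff algebra_simps)

lemma qcnj_sum: "qcnj (sum f A) = (\<Sum>x\<in>A. qcnj (f x))"
  by (induction A rule: infinite_finite_induct) simp_all

lemma norm_qcnj [simp]: "norm (qcnj x) = norm x"
  by (simp add: norm_quat_def inner_quat_def)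

lemma inner_quat_mult_left: "inner (q * x) y = inner x (qcnj q * y)" for q x y :: quat
  by (simp add: inner_quat_def algebra_simps)

lemma qRe_qcnj_mult: "qRe (qcnj x * y) = inner x y"
  by (simp add: inner_quat_def)

lemma of_real_quat_simps [simp]:
  "qRe (of_real r) = r" "qI (of_real r) = 0" "qJ (of_real r) = 0" "qK (of_real r) = 0"
  by (simp_all add: of_real_def)

lemma qcnj_mult_self: "qcnj x * x = of_real ((norm x)\<^sup>2)" "x * qcnj x = of_real ((norm x)\<^sup>2)"
  unfolding power2_norm_eq_inner by (simp_all add: quat_eq_iff inner_quat_def)

text \<open>The regular conjugate of slice regular function theory. The variable commutes with all
  coefficients and is left alone, which is why products are reversed.\<close>

definition fcnj :: "quat fps \<Rightarrow> quat fps" where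
  "fcnj f = Abs_fps (\<lambda>n. qcnj (f $ n))"

definition of_real_fps :: "real fps \<Rightarrow> quat fps" where
  "of_real_fps b = Abs_fps (\<lambda>n. of_real (b $ n))"

lemma fps_mult_nth_rev: "(f * g) $ n = (\<Sum>i\<le>n. f $ (n - i) * g $ i)"
  unfolding fps_mult_nth atLeast0AtMost
  by (rule sum.reindex_bij_witness[where i = "\<lambda>i. n - i" and j = "\<lambda>i. n - i"]) auto

lemma fcnj_mult: "fcnj (f * g) = fcnj g * fcnj f"
  by (rule fps_ext, subst fps_mult_nth_rev) (simp add: fcnj_def fps_mult_nth qcnj_sum atLeast0AtMost)

lemma fcnj_fcnj [simp]: "fcnj (fcnj f) = f"
  by (simp add: fcnj_def fps_eq_iff)

lemma fcnj_one_minus: "fcnj (1 - g) = 1 - fcnj g"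
  by (simp add: fcnj_def fps_eq_iff)

lemma of_real_fps_mult: "of_real_fps (f * g) = of_real_fps f * of_real_fps g"
  by (simp add: of_real_fps_def fps_eq_iff fps_mult_nth)

lemma of_real_fps_one: "of_real_fps 1 = 1"
  by (simp add: of_real_fps_def fps_eq_iff)

lemma l1_fps_fcnj [simp]: "l1_fps (fcnj f) \<longleftrightarrow> l1_fps f"
  by (simp add: l1_fps_def fcnj_def)

lemma l1_fps_of_real_fps [simp]: "l1_fps (of_real_fps f) \<longleftrightarrow> l1_fps f"
  by (simp add: l1_fps_def of_real_fps_def)

lemma l2n_of_real_fps [simp]: "l2n m (of_real_fps f) = l2n m f"
  by (simp add: l2n_def of_real_fps_def)

lemma L2_set_rev: "L2_set (\<lambda>l. f (m - l)) {..m} = L2_set f {..m::nat}"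
  unfolding L2_set_def
  by (rule arg_cong[where f = sqrt], rule sum.reindex_bij_witness[where i = "\<lambda>i. m - i" and j = "\<lambda>i. m - i"]) auto

text \<open>After reversal of the indices below \<open>m + 1\<close>, multiplication by \<open>fcnj g\<close> is the adjoint of
  multiplication by \<open>g\<close>.\<close>

lemma l2_bounded_fcnj:
  assumes "l2_bounded C g"
  shows "l2_bounded C (fcnj g)"
  unfolding l2_bounded_def
proof (intro allI)
  fix m v
  define x where "x = fcnj g * v"
  \<comment> \<open>Pairing \<open>x\<close> with its reversal \<open>y\<close> writes the squared
    norm of \<open>x\<close> as a coefficient pairing at indices with sum \<open>m\<close>, from
    which the conjugated coefficients of \<open>g\<close> can be moved to the other side.\<close>
  define y where "y = Abs_fps (\<lambda>k. x $ (m - k))"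
  have "(l2n m x)\<^sup>2 = (\<Sum>k\<le>m. inner (x $ k) (y $ (m - k)))"
    unfolding l2n_power2 by (simp add: y_def power2_norm_eq_inner)
  \<comment> \<open>The index is kept as \<open>m - (i + (k - i))\<close> so that the summand is
    visibly a function of \<open>i\<close> and \<open>l = k - i\<close>, as the triangle reindexing
    requires.\<close>
  also have "\<dots> = (\<Sum>k\<le>m. \<Sum>i\<le>k. inner (v $ (k - i)) (g $ i * y $ (m - (i + (k - i)))))"
    by (simp add: x_def fps_mult_nth fcnj_def inner_sum_left inner_quat_mult_left atLeast0AtMost)
  also have "\<dots> = (\<Sum>(i, l)\<in>{(i, l). i + l \<le> m}. inner (v $ l) (g $ i * y $ (m - (i + l))))"
    by (subst sum.triangle_reindex_eq) simp
  also have "\<dots> = (\<Sum>(l, i)\<in>Sigma {..m} (\<lambda>l. {..m - l}). inner (v $ l) (g $ i * y $ (m - l - i)))"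
    by (rule sum.reindex_bij_witness[where i = "\<lambda>(l, i). (i, l)" and j = "\<lambda>(i, l). (l, i)"])
      (auto simp: add.commute)
  also have "\<dots> = (\<Sum>l\<le>m. inner (v $ l) ((g * y) $ (m - l)))"
    by (simp add: fps_mult_nth inner_sum_right atLeast0AtMost sum.Sigma)
  also have "\<dots> \<le> (\<Sum>l\<le>m. \<bar>norm (v $ l)\<bar> * \<bar>norm ((g * y) $ (m - l))\<bar>)"
    by (rule sum_mono) (simp add: norm_cauchy_schwarz)
  also have "\<dots> \<le> l2n m v * l2n m (g * y)"
    using L2_set_mult_ineq[of "\<lambda>l. norm (v $ l)" "\<lambda>l. norm ((g * y) $ (m - l))" "{..m}"]
      L2_set_rev[of "\<lambda>l. norm ((g * y) $ l)" m] by (simp add: l2n_def)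
  also have "\<dots> \<le> l2n m v * (C * l2n m y)"
    by (intro mult_left_mono l2_boundedD assms) simp
  also have "l2n m y = l2n m x"
    using L2_set_rev[of "\<lambda>l. norm (x $ l)" m] by (simp add: l2n_def y_def)
  finally have *: "l2n m x * l2n m x \<le> (C * l2n m v) * l2n m x"
    by (simp add: power2_eq_square algebra_simps)
  show "l2n m (fcnj g * v) \<le> C * l2n m v"
  proof (cases "l2n m x = 0")
    case True
    then show ?thesis
      using l2_bounded_nonneg[OF assms] by (simp add: x_def)
  next
    case False
    then have "l2n m x > 0" using l2n_nonneg[of m x] by linarith
    then show ?thesis using * by (simp add: x_def)
  qed
qed

lemma fps_inverse_eqI:
  fixes f :: "'a::division_ring fps"
  assumes "f * g = 1"
  shows "inverse f = g"
proof -
  have "f $ 0 * g $ 0 = 1" using assms by (metis fps_mult_nth_0 fps_one_nth)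
  then have "inverse f * f = 1" by (intro inverse_mult_eq_1) auto
  then show ?thesis by (metis assms mult.assoc mult_1_left mult_1_right)
qed

text \<open>The product of \<open>a = 1 - g\<close> with its conjugate has real coefficients, which reduces the
  claim to the commutative case.\<close>

lemma wiener_quat:
  fixes g :: "quat fps"
  assumes g: "l1_fps g" and bd: "l2_bounded \<rho> g" and \<rho>: "\<rho> < 1"
  shows "l1_fps (inverse (1 - g))"
proof -
  define a where "a = 1 - g"
  define s where "s = a * fcnj a"
  define b where "b = Abs_fps (\<lambda>n. qRe (s $ n))"
  have "a = 1 + - g" by (simp add: a_def)
  then have a_l1: "l1_fps a" using g l1_fps_add l1_fps_one l1_fps_uminus by metis
  have a0: "a $ 0 \<noteq> 0" using l2_bounded_nth[OF bd, of 0] \<rho> by (auto simp: a_def)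
  then have a0': "fcnj a $ 0 \<noteq> 0" by (simp add: fcnj_def quat_eq_iff)
  have sb: "of_real_fps b = s"
  proof -
    have "fcnj s = s" by (simp add: s_def fcnj_mult)
    then have "qcnj (s $ n) = s $ n" for n by (metis fcnj_def fps_nth_Abs_fps)
    then have "of_real (qRe (s $ n)) = s $ n" for n
      by (simp add: quat_eq_iff)
    then show ?thesis by (simp add: of_real_fps_def b_def fps_eq_iff)
  qed
  have "s $ 0 \<noteq> 0" using a0 a0' by (simp add: s_def)
  then have b0: "b $ 0 \<noteq> 0" using sb by (auto simp: of_real_fps_def)
  have b_l1: "l1_fps b" using a_l1 by (metis l1_fps_fcnj l1_fps_mult l1_fps_of_real_fps s_def sb)
  have "s * of_real_fps (inverse b) = 1"
    using b0 by (simp add: sb[symmetric] of_real_fps_mult[symmetric] of_real_fps_one inverse_mult_eq_1')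
  then have is_b: "inverse s = of_real_fps (inverse b)" by (rule fps_inverse_eqI)
  \<comment> \<open>Both factors of the inverse of \<open>s\<close> are inverses of 1 minus a
    contraction by \<open>\<rho>\<close>, since \<open>fcnj a = 1 - fcnj g\<close>.\<close>
  have "s * (inverse (fcnj a) * inverse a) = a * (fcnj a * inverse (fcnj a)) * inverse a"
    by (simp add: s_def mult.assoc)
  also have "\<dots> = 1" using a0 a0' by (simp add: fps_divring_inverse)
  finally have is_a: "inverse s = inverse (fcnj a) * inverse a" by (rule fps_inverse_eqI)
  have "l2_bounded (1 / (1 - \<rho>) * (1 / (1 - \<rho>))) (inverse s)"
    unfolding is_a a_def fcnj_one_minus
    by (intro l2_bounded_mult l2_bounded_inverse l2_bounded_fcnj bd \<rho>)
  \<comment> \<open>Real test series embed isometrically into the quaternionic ones, so the operator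
    bound restricts to them.\<close>
  then have "l2_bounded (1 / (1 - \<rho>) * (1 / (1 - \<rho>))) (inverse b)"
    unfolding l2_bounded_def is_b by (metis l2n_of_real_fps of_real_fps_mult)
  then have "l1_fps (inverse b)" by (rule wiener_real[OF b_l1 b0])
  then have "l1_fps (fcnj a * inverse s)" using a_l1 by (simp add: is_b l1_fps_mult)
  moreover have "inverse a = fcnj a * inverse s"
    using \<open>s $ 0 \<noteq> 0\<close> by (intro fps_inverse_eqI) (simp add: s_def mult.assoc[symmetric] fps_divring_inverse)
  ultimately show ?thesis by (simp add: a_def)
qed

section \<open>The Schur algorithm\<close>

text \<open>The Moebius matrix with rows (1, conjugate of \<gamma>) and (\<gamma>, 1) preserves the
  indefinite form |x|^2 - |y|^2 up to the factor 1 - |\<gamma>|^2. The cross terms cancel because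
  left multiplication by the conjugate of \<gamma> is the adjoint of left multiplication by
  \<gamma>.\<close>

lemma schur_norm_identity:
  fixes \<gamma> x y :: quat
  shows "(norm (x + qcnj \<gamma> * y))\<^sup>2 - (norm (\<gamma> * x + y))\<^sup>2
    = (1 - (norm \<gamma>)\<^sup>2) * ((norm x)\<^sup>2 - (norm y)\<^sup>2)"
proof -
  have "inner (\<gamma> * x) y = inner x (qcnj \<gamma> * y)" by (rule inner_quat_mult_left)
  moreover have "inner (\<gamma> * x) (\<gamma> * x) = (norm \<gamma>)\<^sup>2 * inner x x"
    "inner (qcnj \<gamma> * y) (qcnj \<gamma> * y) = (norm \<gamma>)\<^sup>2 * inner y y"
    by (simp_all add: power2_norm_eq_inner[symmetric] norm_mult power_mult_distrib)
  ultimately show ?thesis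
    unfolding power2_norm_eq_inner[of "_ + _"] power2_norm_eq_inner[of x] power2_norm_eq_inner[of y]
    by (simp add: inner_add_left inner_add_right inner_commute algebra_simps)
qed

text \<open>Constants on the left act on each coefficient separately, so the identity is summed over
  x = \<open>v $ k\<close> and y = \<open>(f * v) $ k\<close>. The forward Schur step takes it at
  -\<gamma>, the backward step at \<gamma>.\<close>

lemma schur_l2n_identity:
  fixes f v :: "quat fps"
  shows "(l2n m ((1 + fps_const (qcnj \<gamma>) * f) * v))\<^sup>2 - (l2n m ((fps_const \<gamma> + f) * v))\<^sup>2
    = (1 - (norm \<gamma>)\<^sup>2) * ((l2n m v)\<^sup>2 - (l2n m (f * v))\<^sup>2)"
  unfolding l2n_power2 sum_subtractf[symmetric] sum_distrib_left schur_norm_identity[symmetric]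
  by (simp add: distrib_right mult.assoc)

section \<open>The forward Schur step\<close>

definition strictly_contractive :: "quat fps \<Rightarrow> bool" where
  "strictly_contractive f \<longleftrightarrow> (\<forall>m v. l2n m v \<noteq> 0 \<longrightarrow> l2n m (f * v) < l2n m v)"

lemma l2n_eq_0_mult: "l2n m (v::quat fps) = 0 \<Longrightarrow> l2n m (f * v) = 0"
  using l2n_mult[of m f v] l2n_nonneg[of m "f * v"] by simp

lemma l2n_Suc_X: "l2n (Suc m) (fps_X * f) = l2n m (f :: 'a::real_normed_algebra_1 fps)"
  by (rule power2_eq_imp_eq) (simp_all add: l2n_power2 sum.atMost_Suc_shift del: sum.atMost_Suc)

lemma l1n_Suc_X: "l1n (Suc m) (fps_X * f) = l1n m (f :: 'a::real_normed_algebra_1 fps)"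
  by (simp add: l1n_def sum.atMost_Suc_shift del: sum.atMost_Suc)

text \<open>The factor \<open>fps_X\<close> raises the truncation index by one, at which one more
  coefficient of \<open>v\<close> would count. Cutting it off changes neither \<open>v\<close> nor
  \<open>f * v\<close> up to index \<open>m\<close>.\<close>

lemma strictly_contractive_X:
  assumes "strictly_contractive (fps_X * f)"
  shows "strictly_contractive f"
  unfolding strictly_contractive_def
proof (intro allI impI)
  fix m and v :: "quat fps" assume "l2n m v \<noteq> 0"
  define v' where "v' = fps_cutoff (Suc m) v"
  have "(f * v') $ k = (f * v) $ k" if "k \<le> m" for k
    using that by (simp add: v'_def fps_cutoff_right_mult_nth)
  then have 1: "l2n m (f * v') = l2n m (f * v)" unfolding l2n_def by (intro L2_set_cong) auto
  have 2: "l2n (Suc m) v' = l2n m v"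
    by (rule power2_eq_imp_eq) (simp_all add: l2n_power2 v'_def)
  have "l2n (Suc m) (fps_X * f * v') < l2n (Suc m) v'"
    using assms[unfolded strictly_contractive_def, rule_format, of "Suc m" v'] \<open>l2n m v \<noteq> 0\<close> 2
    by simp
  then show "l2n m (f * v) < l2n m v"
    using 1 2 by (simp add: mult.assoc l2n_Suc_X)
qed

lemma strictly_contractive_nth_0:
  assumes "strictly_contractive f"
  shows "norm (f $ 0) < 1"
  using assms[unfolded strictly_contractive_def, rule_format, of 0 1] norm_nth_le_l2n[of 0 0 f]
  by (simp add: l2n_one)

text \<open>Substituting \<open>v = d * u\<close> clears the denominator: \<open>h * v\<close>
  becomes \<open>(f - fps_const \<gamma>) * u\<close>, and the norm identity at -\<gamma> transfers
  the strict inequality from \<open>u\<close> to \<open>v\<close>.\<close>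

lemma strictly_contractive_schur_step:
  assumes f: "strictly_contractive f" and \<gamma>: "\<gamma> = f $ 0"
    and h: "h = (f - fps_const \<gamma>) * inverse (1 - fps_const (qcnj \<gamma>) * f)"
  shows "strictly_contractive h"
  unfolding strictly_contractive_def
proof (intro allI impI)
  fix m and v :: "quat fps" assume v: "l2n m v \<noteq> 0"
  define d where "d = 1 - fps_const (qcnj \<gamma>) * f"
  define u where "u = inverse d * v"
  have \<gamma>1: "(norm \<gamma>)\<^sup>2 < 1" using strictly_contractive_nth_0[OF f] by (simp add: \<gamma> power_less_one_iff)
  have "d $ 0 = of_real (1 - (norm \<gamma>)\<^sup>2)"
    using qcnj_mult_self(1)[of \<gamma>] by (simp add: d_def \<gamma>)
  moreover have "1 - (norm \<gamma>)\<^sup>2 \<noteq> 0" using \<gamma>1 by simp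
  ultimately have "d $ 0 \<noteq> 0" by (metis of_real_eq_0_iff)
  then have du: "d * u = v" by (simp add: u_def mult.assoc[symmetric] fps_divring_inverse)
  have hu: "h * v = (f - fps_const \<gamma>) * u" by (simp add: h u_def d_def mult.assoc)
  have "l2n m u \<noteq> 0" using v du l2n_eq_0_mult by metis
  then have "(l2n m (f * u))\<^sup>2 < (l2n m u)\<^sup>2"
    using f l2n_nonneg by (intro power_strict_mono) (auto simp: strictly_contractive_def)
  then have "0 < (1 - (norm (- \<gamma>))\<^sup>2) * ((l2n m u)\<^sup>2 - (l2n m (f * u))\<^sup>2)"
    using \<gamma>1 by simp
  also have "\<dots> = (l2n m v)\<^sup>2 - (l2n m (h * v))\<^sup>2"
    unfolding schur_l2n_identity[symmetric] hu
    by (simp add: fps_const_neg[symmetric] del: fps_const_neg flip: du d_def)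
  finally show "l2n m (h * v) < l2n m v" by (simp add: power2_less_imp_less)
qed

text \<open>Solving for \<open>f\<close> gives a quotient with the factor 1 + h \<gamma>' on the
  left, where \<gamma>' is the conjugate of \<gamma>. It is also a quotient with 1 + \<gamma>' h on
  the right, because (\<gamma> + h)(1 + \<gamma>' h) = (1 + h \<gamma>')(\<gamma> + h): the two
  sides differ only in the position of the real number |\<gamma>|^2.\<close>

lemma schur_step_inverse:
  assumes \<gamma>: "\<gamma> = f $ 0" "norm \<gamma> < 1"
    and h: "h = (f - fps_const \<gamma>) * inverse (1 - fps_const (qcnj \<gamma>) * f)" and h0: "h $ 0 = 0"
  shows "f * (1 + fps_const (qcnj \<gamma>) * h) = fps_const \<gamma> + h"
proof -
  let ?c = "fps_const \<gamma>" and ?c' = "fps_const (qcnj \<gamma>)"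
  define d where "d = 1 - ?c' * f"
  have "d $ 0 = of_real (1 - (norm \<gamma>)\<^sup>2)"
    using qcnj_mult_self(1)[of \<gamma>] by (simp add: d_def \<gamma>(1))
  moreover have "1 - (norm \<gamma>)\<^sup>2 \<noteq> 0" using power_less_one_iff[of "norm \<gamma>" 2] \<gamma>(2) by simp
  ultimately have "d $ 0 \<noteq> 0" by (metis of_real_eq_0_iff)
  then have "h * d = f - ?c" by (simp add: h d_def[symmetric] mult.assoc fps_divring_inverse)
  then have 1: "?c + h = (1 + h * ?c') * f" by (simp add: d_def algebra_simps)
  have cc: "?c * ?c' = ?c' * ?c" "h * (?c' * ?c) = ?c' * ?c * h"
    by (simp_all add: qcnj_mult_self fps_eq_iff of_real_def)
  have "(1 + h * ?c') * (f * (1 + ?c' * h)) = (?c + h) * (1 + ?c' * h)"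
    by (simp add: 1 mult.assoc)
  also have "\<dots> = (1 + h * ?c') * (?c + h)"
    using cc by (simp add: distrib_left distrib_right mult.assoc[symmetric] del: fps_const_mult)
  finally have 2: "(1 + h * ?c') * (f * (1 + ?c' * h)) = (1 + h * ?c') * (?c + h)" .
  \<comment> \<open>A nonzero factor can be cancelled, as quaternionic power series have no zero
    divisors.\<close>
  have "(1 + h * ?c') $ 0 \<noteq> 0" using h0 by simp
  then have "1 + h * ?c' \<noteq> 0" by (metis fps_zero_nth)
  then show ?thesis using 2 by simp
qed

section \<open>The backward Schur step\<close>

text \<open>The invariant of the backward recursion: the uniform gap is what lets the Wiener lemma
  invert the next denominator inside l^1.\<close>

definition l1_contraction :: "quat fps \<Rightarrow> bool" where
  "l1_contraction f \<longleftrightarrow> l1_fps f \<and> (\<exists>\<rho><1. l2_bounded \<rho> f)"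

lemma l2_bounded_const: "l2_bounded (norm a) (fps_const a)" for a :: quat
  by (rule l2_bounded_l1) (simp add: l1n_const)

lemma l1_contraction_X:
  assumes "l1_contraction f"
  shows "l1_contraction (fps_X * f)"
proof -
  have "l2_bounded 1 (fps_X :: quat fps)"
  proof (rule l2_bounded_l1)
    fix m
    have "l1n m (fps_X :: quat fps) = (\<Sum>k\<le>m. if k = 1 then 1 else 0)"
      unfolding l1n_def by (rule sum.cong) auto
    then show "l1n m (fps_X :: quat fps) \<le> 1" by simp
  qed
  then have "l2_bounded (1 * \<rho>) (fps_X * f)" if "l2_bounded \<rho> f" for \<rho>
    using that by (rule l2_bounded_mult)
  then show ?thesis using assms by (auto simp: l1_contraction_def l1_fps_X l1_fps_mult)
qed

text \<open>The denominator is \<open>1 - g\<close> with \<open>g\<close> again bounded by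
  \<open>\<rho>\<close>, so the Wiener lemma puts \<open>f\<close> into l^1. For the gap, the norm
  identity bounds |u|^2 - |f u|^2 below by \<delta> |v|^2, and |u| is at most 2 |v|, so at least
  \<delta>/4 times |u|^2 is lost.\<close>

lemma l1_contraction_schur_step:
  assumes h: "l1_contraction h" and \<gamma>: "norm \<gamma> < 1"
    and f: "f * (1 + fps_const (qcnj \<gamma>) * h) = fps_const \<gamma> + h"
  shows "l1_contraction f"
proof -
  obtain \<rho> where \<rho>: "\<rho> < 1" "l2_bounded \<rho> h" and h1: "l1_fps h"
    using h by (auto simp: l1_contraction_def)
  have \<rho>0: "0 \<le> \<rho>" using \<rho>(2) by (rule l2_bounded_nonneg)
  define g where "g = fps_const (- qcnj \<gamma>) * h"
  have d: "1 + fps_const (qcnj \<gamma>) * h = 1 - g"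
    by (simp add: g_def fps_const_neg[symmetric] del: fps_const_neg)
  have "l2_bounded (norm \<gamma> * \<rho>) g"
    using l2_bounded_mult[OF l2_bounded_const[of "- qcnj \<gamma>"] \<rho>(2)] by (simp add: g_def)
  then have g: "l2_bounded \<rho> g"
    using \<gamma> \<rho>0 by (elim l2_bounded_mono) (simp add: mult_left_le_one_le)
  then have "l1_fps (inverse (1 - g))"
    by (intro wiener_quat[OF _ _ \<rho>(1)]) (auto simp: g_def intro: l1_fps_mult l1_fps_const h1)
  have g0: "(1 - g) $ 0 \<noteq> 0" using l2_bounded_nth[OF g, of 0] \<rho>(1) by auto
  then have "f = (fps_const \<gamma> + h) * inverse (1 - g)"
    by (simp add: f[unfolded d, symmetric] mult.assoc fps_divring_inverse)
  then have f1: "l1_fps f"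
    using \<open>l1_fps (inverse (1 - g))\<close> by (simp add: l1_fps_add l1_fps_const l1_fps_mult h1)
  define \<delta> where "\<delta> = (1 - (norm \<gamma>)\<^sup>2) * (1 - \<rho>\<^sup>2)"
  have "\<delta> > 0" "\<delta> \<le> 1"
    using \<gamma> \<rho>(1) \<rho>0 by (auto simp: \<delta>_def power_less_one_iff intro!: mult_le_one power_le_one)
  have "l2_bounded (sqrt (1 - \<delta> / 4)) f"
    unfolding l2_bounded_def
  proof (intro allI)
    fix m u
    define v where "v = inverse (1 - g) * u"
    have u: "u = (1 - g) * v" using g0 by (simp add: v_def mult.assoc[symmetric] fps_divring_inverse)
    have fu: "f * u = (fps_const \<gamma> + h) * v" using f by (simp add: u d mult.assoc[symmetric])
    have "l2n m (h * v) \<le> \<rho> * l2n m v" using \<rho>(2) by (rule l2_boundedD)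
    then have "(l2n m (h * v))\<^sup>2 \<le> \<rho>\<^sup>2 * (l2n m v)\<^sup>2"
      by (metis l2n_nonneg power_mono power_mult_distrib)
    then have "(1 - (norm \<gamma>)\<^sup>2) * ((1 - \<rho>\<^sup>2) * (l2n m v)\<^sup>2)
        \<le> (1 - (norm \<gamma>)\<^sup>2) * ((l2n m v)\<^sup>2 - (l2n m (h * v))\<^sup>2)"
      using \<gamma> by (intro mult_left_mono) (auto simp: algebra_simps power_le_one)
    also have "\<dots> = (l2n m u)\<^sup>2 - (l2n m (f * u))\<^sup>2"
      unfolding schur_l2n_identity[symmetric] fu d by (simp flip: u)
    finally have 1: "\<delta> * (l2n m v)\<^sup>2 \<le> (l2n m u)\<^sup>2 - (l2n m (f * u))\<^sup>2"
      by (simp add: \<delta>_def mult.assoc)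
    have "l2n m u \<le> l2n m v + l2n m (g * v)"
      using l2n_diff[of m v "g * v"] by (simp add: u algebra_simps)
    also have "\<dots> \<le> 2 * l2n m v"
      using l2_boundedD[OF l2_bounded_mono[OF g, of 1], of m v] \<rho>(1) by simp
    finally have "(l2n m u)\<^sup>2 \<le> 4 * (l2n m v)\<^sup>2"
      using power_mono[of "l2n m u" "2 * l2n m v" 2] by (simp add: power_mult_distrib)
    then have "\<delta> * (l2n m u)\<^sup>2 \<le> \<delta> * (4 * (l2n m v)\<^sup>2)"
      using \<open>\<delta> > 0\<close> by (intro mult_left_mono) auto
    then have "(l2n m (f * u))\<^sup>2 \<le> (1 - \<delta> / 4) * (l2n m u)\<^sup>2"
      using 1 by (simp add: algebra_simps)
    then have "sqrt ((l2n m (f * u))\<^sup>2) \<le> sqrt ((1 - \<delta> / 4) * (l2n m u)\<^sup>2)"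
      by (rule real_sqrt_le_mono)
    then show "l2n m (f * u) \<le> sqrt (1 - \<delta> / 4) * l2n m u"
      by (simp add: real_sqrt_mult)
  qed
  moreover have "sqrt (1 - \<delta> / 4) < 1" using \<open>\<delta> > 0\<close> by simp
  ultimately show ?thesis using f1 unfolding l1_contraction_def by blast
qed

text \<open>While the coefficients are small, the \<open>\<ell>\<^sup>1\<close> norm of the iterates grows by at most
  \<open>2 |\<gamma>\<^sub>n|\<close> in each backward step of the algorithm.\<close>

lemma schur_tail:
  fixes f :: "nat \<Rightarrow> quat fps"
  assumes f: "\<And>n. f n * (1 + fps_const (qcnj (\<gamma> n)) * (fps_X * f (Suc n)))
      = fps_const (\<gamma> n) + fps_X * f (Suc n)"
    and nth: "\<And>n. f n $ 0 = \<gamma> n"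
    and small: "\<And>n m. n \<ge> N \<Longrightarrow> (\<Sum>k=n..n+m. norm (\<gamma> k)) \<le> 1 / 4"
  shows "n \<ge> N \<Longrightarrow> l1n m (f n) \<le> 2 * (\<Sum>k=n..n+m. norm (\<gamma> k))"
proof (induction m arbitrary: n)
  case 0
  then show ?case by (simp add: l1n_def nth)
next
  case (Suc m)
  \<comment> \<open>The factor \<open>fps_X\<close> lowers the truncation index, so
    \<open>f n\<close> up to \<open>Suc m\<close> involves \<open>f (Suc n)\<close> only up to
    \<open>m\<close>. Induction on the truncation index, for all \<open>n\<close> at once, replaces
    a start of the recursion at infinity.\<close>
  define x where "x = l1n m (f (Suc n))"
  define t where "t = norm (\<gamma> n)"
  define y where "y = l1n (Suc m) (f n)"
  have S: "(\<Sum>k=n..n + Suc m. norm (\<gamma> k)) = t + (\<Sum>k=Suc n..Suc n+m. norm (\<gamma> k))"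
    by (simp add: sum.atLeast_Suc_atMost t_def)
  have xS: "x \<le> 2 * (\<Sum>k=Suc n..Suc n+m. norm (\<gamma> k))"
    unfolding x_def using Suc.IH[of "Suc n"] Suc.prems by (simp del: sum.cl_ivl_Suc)
  have "(\<Sum>k=Suc n..Suc n+m. norm (\<gamma> k)) \<le> 1 / 4" using small[of "Suc n" m] Suc.prems by simp
  then have x: "x \<ge> 0" "x \<le> 1 / 2" using xS by (auto simp: x_def)
  have t: "t \<ge> 0" "t \<le> 1 / 4" using small[of n 0] Suc.prems by (auto simp: t_def)
  let ?h = "fps_X * f (Suc n)"
  have "f n = fps_const (\<gamma> n) + ?h + - (f n * (fps_const (qcnj (\<gamma> n)) * ?h))"
    using f[of n] by (simp add: algebra_simps)
  then have "y \<le> l1n (Suc m) (fps_const (\<gamma> n) + ?h) + l1n (Suc m) (f n * (fps_const (qcnj (\<gamma> n)) * ?h))"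
    unfolding y_def by (metis l1n_add l1n_uminus)
  also have "\<dots> \<le> (t + x) + y * (t * x)"
  proof (rule add_mono)
    show "l1n (Suc m) (fps_const (\<gamma> n) + ?h) \<le> t + x"
      using l1n_add[of "Suc m" "fps_const (\<gamma> n)" ?h] by (simp add: l1n_const l1n_Suc_X x_def t_def)
    have "l1n (Suc m) (fps_const (qcnj (\<gamma> n)) * ?h) \<le> t * x"
      using l1n_mult[of "Suc m" "fps_const (qcnj (\<gamma> n))" ?h] by (simp add: l1n_const l1n_Suc_X x_def t_def)
    then show "l1n (Suc m) (f n * (fps_const (qcnj (\<gamma> n)) * ?h)) \<le> y * (t * x)"
      unfolding y_def by (meson l1n_mult l1n_nonneg mult_left_mono order_trans)
  qed
  finally have y: "y * (1 - t * x) \<le> t + x" by (simp add: algebra_simps)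
  have "t * x \<le> 1 / 4 * (1 / 2)" using x t by (intro mult_mono) auto
  moreover have "x * x \<le> 1 / 2 * (1 / 2)" using x by (intro mult_mono) auto
  \<comment> \<open>The right side minus the left side of the next inequality is
    \<open>t - t * (x * x + 2 * (t * x))\<close>. The bound 1/4 on the tails keeps \<open>x\<close>
    below 1/2, which leaves ample room and makes \<open>1 - t * x\<close> positive.\<close>
  ultimately have "t * (x * x + 2 * (t * x)) \<le> t * 1" using t by (intro mult_left_mono) auto
  then have "t + x \<le> (x + 2 * t) * (1 - t * x)" by (simp add: algebra_simps)
  then have "y * (1 - t * x) \<le> (x + 2 * t) * (1 - t * x)" using y by linarith
  then have "y \<le> x + 2 * t" using \<open>t * x \<le> _\<close> by (simp add: mult_le_cancel_right)
  then show ?case unfolding S using xS by (simp add: y_def)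
qed

section \<open>Positive definite sequences\<close>

text \<open>A real-valued quaternionic quadratic form forces its matrix to be Hermitian. Test
  vectors with entries 1 and q at the indices 0 and n show that c_n q plus the conjugate of q times
  c_(-n) is real; q = 1 compares the imaginary parts and one imaginary unit the real parts.\<close>

lemma positive_definite_hermitian:
  assumes "positive_definite_seq c" "c 0 = 1"
  shows "c (- n) = qcnj (c n)"
proof -
  have *: "c (- int n) = qcnj (c (int n))" for n
  proof (cases "n = 0")
    case False
    have real: "c (int n) * q + qcnj q * c (- int n) \<in> \<real>" for q
    proof -
      define \<xi> where "\<xi> k = (if k = 0 then 1 else if k = n then q else 0)" for k :: nat
      have "qnonneg (quad_form (n + 1) (toeplitz c) \<xi>)"
        using assms(1) by (simp add: positive_definite_seq_def pos_semidef_on_def)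
      moreover have "quad_form (n + 1) (toeplitz c) \<xi>
          = (\<Sum>k\<in>{0, n}. \<Sum>l\<in>{0, n}. qcnj (\<xi> k) * toeplitz c k l * \<xi> l)"
        unfolding quad_form_def
        by (intro sum.mono_neutral_cong_right) (auto simp: \<xi>_def intro!: sum.neutral sum.mono_neutral_right)
      moreover have "\<dots> = 1 + qcnj q * q + (c (int n) * q + qcnj q * c (- int n))"
        using False assms(2) by (simp add: \<xi>_def toeplitz_def)
      ultimately have "of_real (1 + (norm q)\<^sup>2) + (c (int n) * q + qcnj q * c (- int n)) \<in> \<real>"
        by (simp add: qnonneg_def qcnj_mult_self)
      then show ?thesis by (metis Reals_diff Reals_of_real add_diff_cancel_left')
    qed
    have im: "q \<in> \<real> \<Longrightarrow> qI q = 0 \<and> qJ q = 0 \<and> qK q = 0" for q by (auto elim: Reals_cases)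
    show ?thesis
      using im[OF real[of 1]] im[OF real[of "Quat 0 1 0 0"]] by (simp add: quat_eq_iff)
  qed (simp add: assms)
  show ?thesis
  proof (cases "n \<ge> 0")
    case True
    then show ?thesis using *[of "nat n"] by simp
  next
    case False
    then show ?thesis using *[of "nat (- n)"] by simp
  qed
qed

lemma sum_symmetric_split:
  fixes s :: "nat \<Rightarrow> nat \<Rightarrow> real"
  assumes "\<And>k l. s k l = s l k"
  shows "(\<Sum>k<N. \<Sum>l<N. s k l) = (\<Sum>k<N. s k k + 2 * (\<Sum>l<k. s k l))"
proof (induction N)
  case (Suc N)
  have "(\<Sum>k<N. s k N) = (\<Sum>l<N. s N l)" using assms by (metis (no_types))
  then show ?case using Suc by (simp add: sum.distrib)
qed simp

text \<open>Multiplication by F has a lower triangular matrix with diagonal 1 and entries 2 c(l - k)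
  below it. Its Hermitian part is the Toeplitz matrix, whose form at \<open>w\<close> is therefore
  the real part of the pairing of \<open>w\<close> with F w.\<close>

lemma positive_definite_strictly_contractive:
  assumes c: "nontrivial_positive_definite_seq c" "c 0 = 1"
    and F: "herglotz_series c = (1 + fps_X * f) * inverse (1 - fps_X * f)"
  shows "strictly_contractive (fps_X * f)"
  unfolding strictly_contractive_def
proof (intro allI impI)
  fix m and v :: "quat fps" assume v: "l2n m v \<noteq> 0"
  define w where "w = (1 - fps_X * f) * v"
  let ?F = "herglotz_series c"
  have vw: "v = inverse (1 - fps_X * f) * w"
    by (simp add: w_def mult.assoc[symmetric] fps_divring_inverse)
  have Fw: "?F * w = (1 + fps_X * f) * v"
    by (simp add: F vw mult.assoc)
  have "l2n m w \<noteq> 0" using v vw l2n_eq_0_mult by metis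
  then have "\<exists>k<m+1. w $ k \<noteq> 0"
    unfolding l2n_def by (auto simp: L2_set_eq_0_iff less_Suc_eq_le)
  then have "qpos (quad_form (m + 1) (toeplitz c) (\<lambda>k. w $ k))"
    using c(1) by (simp add: nontrivial_positive_definite_seq_def pos_def_on_def)
  then have pos: "0 < qRe (quad_form (m + 1) (toeplitz c) (\<lambda>k. w $ k))" by (simp add: qpos_def)
  define s where "s k l = inner (w $ k) (c (int l - int k) * w $ l)" for k l
  have herm: "c (- n) = qcnj (c n)" for n
    using positive_definite_hermitian c by (auto simp: nontrivial_positive_definite_seq_def)
  have sym: "s k l = s l k" for k l
    using herm[of "int l - int k"]
    by (simp add: s_def inner_quat_mult_left[symmetric] inner_commute[of "w $ k"])
  have qRe_sum: "qRe (sum g A) = (\<Sum>x\<in>A. qRe (g x))" for g and A :: "nat set"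
    by (induction A rule: infinite_finite_induct) simp_all
  have "qRe (quad_form (m + 1) (toeplitz c) (\<lambda>k. w $ k)) = (\<Sum>k<m+1. \<Sum>l<m+1. s k l)"
    unfolding quad_form_def qRe_sum s_def toeplitz_def mult.assoc qRe_qcnj_mult ..
  also have "\<dots> = (\<Sum>k<m+1. s k k + 2 * (\<Sum>l<k. s k l))"
    by (rule sum_symmetric_split[OF sym])
  also have "\<dots> = (\<Sum>k<m+1. inner (w $ k) ((?F * w) $ k))"
  proof (rule sum.cong)
    fix k
    have "(?F * w) $ k = (\<Sum>l<k. 2 *\<^sub>R (c (int l - int k) * w $ l)) + w $ k"
      unfolding fps_mult_nth_rev lessThan_Suc_atMost[symmetric] sum.lessThan_Suc
      by (simp add: herglotz_series_def of_nat_diff scaleR_conv_of_real mult.assoc)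
    then show "s k k + 2 * (\<Sum>l<k. s k l) = inner (w $ k) ((?F * w) $ k)"
      by (simp add: s_def inner_add_right inner_sum_right sum_distrib_left c(2))
  qed simp
  also have "\<dots> = (\<Sum>k\<le>m. (norm (v $ k))\<^sup>2 - (norm ((fps_X * f * v) $ k))\<^sup>2)"
  proof (rule sum.cong)
    fix k
    have 1: "(?F * w) $ k = v $ k + (fps_X * f * v) $ k" unfolding Fw by (simp add: distrib_right)
    have 2: "w $ k = v $ k - (fps_X * f * v) $ k" unfolding w_def by (simp add: left_diff_distrib)
    show "inner (w $ k) ((?F * w) $ k) = (norm (v $ k))\<^sup>2 - (norm ((fps_X * f * v) $ k))\<^sup>2"
      unfolding 1 unfolding 2
      by (simp add: power2_norm_eq_inner inner_diff_left inner_diff_right inner_add_right inner_commute)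
  qed auto
  also have "\<dots> = (l2n m v)\<^sup>2 - (l2n m (fps_X * f * v))\<^sup>2"
    by (simp add: l2n_power2 sum_subtractf)
  finally show "l2n m (fps_X * f * v) < l2n m v"
    using pos by (simp add: power2_less_imp_less)
qed

theorem verblunsky_summable_imp_moments_summable:
  assumes c: "nontrivial_positive_definite_seq c" "c 0 = 1"
    and v: "verblunsky_coeffs c \<gamma>" and sm: "summable (\<lambda>n. norm (\<gamma> n))"
  shows "summable (\<lambda>n. norm (c (- int n)))"
proof -
  obtain f where F: "herglotz_series c = (1 + fps_X * f 0) * inverse (1 - fps_X * f 0)"
    and \<gamma>: "\<And>n. \<gamma> n = f n $ 0"
    and step: "\<And>n. fps_X * f (Suc n) =
             (f n - fps_const (\<gamma> n)) * inverse (1 - fps_const (qcnj (\<gamma> n)) * f n)"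
    using v unfolding verblunsky_coeffs_def schur_function_of_def by blast
  have sc: "strictly_contractive (f n)" for n
  proof (induction n)
    case 0
    show ?case using positive_definite_strictly_contractive[OF c F] by (rule strictly_contractive_X)
  next
    case (Suc n)
    then show ?case
      using strictly_contractive_schur_step[OF _ \<gamma> step] by (blast intro: strictly_contractive_X)
  qed
  have \<gamma>1: "norm (\<gamma> n) < 1" for n using strictly_contractive_nth_0[OF sc] by (simp add: \<gamma>)
  have rel: "f n * (1 + fps_const (qcnj (\<gamma> n)) * (fps_X * f (Suc n))) = fps_const (\<gamma> n) + fps_X * f (Suc n)" for n
    by (rule schur_step_inverse[OF \<gamma> \<gamma>1 step]) simp
  have "\<exists>N. \<forall>n\<ge>N. \<forall>m. norm (\<Sum>k=n..<m. norm (\<gamma> k)) < 1 / 4"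
    using sm[unfolded summable_Cauchy, rule_format, of "1/4"] by simp
  then obtain N where N: "\<And>m n. n \<ge> N \<Longrightarrow> norm (\<Sum>k=n..<m. norm (\<gamma> k)) < 1 / 4"
    by blast
  have small: "(\<Sum>k=n..n+m. norm (\<gamma> k)) \<le> 1 / 4" if "n \<ge> N" for n m
    using N[OF that, of "Suc (n + m)"]
    unfolding atLeastLessThanSuc_atLeastAtMost[symmetric] real_norm_def by linarith
  have "l1n m (f N) \<le> 1 / 2" for m
    using schur_tail[of f \<gamma> N N m, OF rel \<gamma>[symmetric] small] small[of N m] by simp
  \<comment> \<open>An l^1 norm of at most 1/2 is at the same time the uniform l^2 gap that starts
    the backward induction.\<close>
  then have "l1_contraction (f N)"
    unfolding l1_contraction_def l1_fps_iff_bounded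
    by (intro conjI exI[of _ "1/2"] allI l2_bounded_l1) auto
  then have "l1_contraction (f (N - k))" if "k \<le> N" for k using that
  proof (induction k)
    case (Suc k)
    then have "l1_contraction (fps_X * f (Suc (N - Suc k)))"
      by (auto intro: l1_contraction_X simp: Suc_diff_Suc)
    then show ?case by (rule l1_contraction_schur_step[OF _ \<gamma>1 rel])
  qed simp
  from this[of N] have *: "l1_contraction (fps_X * f 0)" by (auto intro: l1_contraction_X)
  then have "l1_fps (1 + fps_X * f 0)" "l1_fps (inverse (1 - fps_X * f 0))"
    unfolding l1_contraction_def by (blast intro: l1_fps_add l1_fps_one wiener_quat)+
  then have "l1_fps (herglotz_series c)" unfolding F by (rule l1_fps_mult)
  then have "summable (\<lambda>n. norm (herglotz_series c $ n))" by (simp add: l1_fps_def)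
  then show ?thesis
    by (rule summable_comparison_test'[where N = 0]) (auto simp: herglotz_series_def norm_mult c(2))
qed

section \<open>Signed measures\<close>

text \<open>The codomain is left general so that a quaternion-valued measure and its real components
  fall under the same notion.\<close>

definition signed_measure :: "'a measure \<Rightarrow> ('a set \<Rightarrow> 'b::real_normed_vector) \<Rightarrow> bool" where
  "signed_measure M \<nu> \<longleftrightarrow>
     (\<forall>A. range A \<subseteq> sets M \<longrightarrow> disjoint_family A \<longrightarrow> (\<lambda>n. \<nu> (A n)) sums \<nu> (\<Union>n::nat. A n))"

lemma signed_measureD:
  "signed_measure M \<nu> \<Longrightarrow> range A \<subseteq> sets M \<Longrightarrow> disjoint_family A \<Longrightarrow>
    (\<lambda>n. \<nu> (A n)) sums \<nu> (\<Union>n::nat. A n)"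
  by (simp add: signed_measure_def)

lemma signed_measure_empty:
  assumes "signed_measure M \<nu>"
  shows "\<nu> {} = 0"
proof -
  have "(\<lambda>n. \<nu> {}) sums \<nu> (\<Union>n::nat. {})"
    using assms by (rule signed_measureD) (auto simp: disjoint_family_on_def)
  then have "summable (\<lambda>n::nat. \<nu> {})" by (rule sums_summable)
  then show ?thesis by (simp add: summable_const_iff)
qed

lemma signed_measure_Un:
  assumes \<nu>: "signed_measure M \<nu>" and AB: "A \<in> sets M" "B \<in> sets M" "A \<inter> B = {}"
  shows "\<nu> (A \<union> B) = \<nu> A + \<nu> B"
proof -
  have "(\<lambda>n. \<nu> (binaryset A B n)) sums \<nu> (\<Union>n. binaryset A B n)"
    using AB by (intro signed_measureD[OF \<nu>]) (auto simp: range_binaryset_eq disjoint_family_on_def binaryset_def)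
  moreover have "(\<lambda>n. \<nu> (binaryset A B n)) sums (\<nu> A + \<nu> B)"
    using signed_measure_empty[OF \<nu>] by (rule binaryset_sums)
  ultimately show ?thesis by (simp add: UN_binaryset_eq sums_iff)
qed

lemma signed_measure_Diff:
  assumes "signed_measure M \<nu>" "A \<in> sets M" "B \<in> sets M" "A \<subseteq> B"
  shows "\<nu> (B - A) = \<nu> B - \<nu> A"
proof -
  have "\<nu> (A \<union> (B - A)) = \<nu> A + \<nu> (B - A)"
    using assms by (intro signed_measure_Un) auto
  moreover have "A \<union> (B - A) = B" using assms by auto
  ultimately show ?thesis by simp
qed

lemma signed_measure_uminus: "signed_measure M \<nu> \<Longrightarrow> signed_measure M (\<lambda>A. - \<nu> A)"
  by (auto simp: signed_measure_def intro: sums_minus)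

lemma signed_measure_bounded_linear:
  "bounded_linear f \<Longrightarrow> signed_measure M \<nu> \<Longrightarrow> signed_measure M (\<lambda>A. f (\<nu> A))"
  by (auto simp: signed_measure_def intro: bounded_linear.sums)

text \<open>If \<open>\<nu>\<close> is unbounded on the subsets of \<open>A\<close>, then \<open>A\<close> has a subset with the same property on
  which \<open>|\<nu>|\<close> is large. Iteration gives a decreasing sequence that contradicts continuity from
  above.\<close>

lemma signed_measure_bounded:
  fixes \<nu> :: "'a set \<Rightarrow> real"
  assumes \<nu>: "signed_measure M \<nu>"
  shows "\<exists>K. \<forall>A\<in>sets M. \<bar>\<nu> A\<bar> \<le> K"
proof (rule ccontr)
  assume unbounded: "\<not> ?thesis"
  define bad where "bad A \<longleftrightarrow> A \<in> sets M \<and> (\<forall>K. \<exists>B\<in>sets M. B \<subseteq> A \<and> K < \<bar>\<nu> B\<bar>)" for A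
  have "\<exists>A'. bad A' \<and> A' \<subseteq> A \<and> K \<le> \<bar>\<nu> A'\<bar>" if A: "bad A" for A K
  proof -
    \<comment> \<open>The excess over |\<nu> A| makes both \<open>B\<close> and \<open>A - B\<close>
      large, so whichever of the two is bad can be taken.\<close>
    obtain B where B: "B \<in> sets M" "B \<subseteq> A" "\<bar>\<nu> A\<bar> + \<bar>K\<bar> < \<bar>\<nu> B\<bar>"
      using A unfolding bad_def by blast
    have AM: "A \<in> sets M" using A by (simp add: bad_def)
    have AB: "\<nu> (A - B) = \<nu> A - \<nu> B" using \<nu> B AM by (intro signed_measure_Diff)
    have "bad B \<or> bad (A - B)"
    proof (rule ccontr)
      assume "\<not> (bad B \<or> bad (A - B))"
      then have ex: "\<exists>K1. \<forall>C\<in>sets M. C \<subseteq> B \<longrightarrow> \<bar>\<nu> C\<bar> \<le> K1"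
        "\<exists>K2. \<forall>C\<in>sets M. C \<subseteq> A - B \<longrightarrow> \<bar>\<nu> C\<bar> \<le> K2"
        using B(1) sets.Diff[OF AM B(1)] by (auto simp: bad_def not_less)
      obtain K1 where K1: "\<forall>C\<in>sets M. C \<subseteq> B \<longrightarrow> \<bar>\<nu> C\<bar> \<le> K1" using ex(1) ..
      obtain K2 where K2: "\<forall>C\<in>sets M. C \<subseteq> A - B \<longrightarrow> \<bar>\<nu> C\<bar> \<le> K2" using ex(2) ..
      obtain C where C: "C \<in> sets M" "C \<subseteq> A" "K1 + K2 < \<bar>\<nu> C\<bar>"
        using A[unfolded bad_def, THEN conjunct2, THEN spec, of "K1 + K2"] by blast
      have "\<nu> (C \<inter> B \<union> (C - B)) = \<nu> (C \<inter> B) + \<nu> (C - B)"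
        using C B by (intro signed_measure_Un[OF \<nu>]) auto
      moreover have "C \<inter> B \<union> (C - B) = C" by blast
      moreover have "\<bar>\<nu> (C \<inter> B)\<bar> \<le> K1" "\<bar>\<nu> (C - B)\<bar> \<le> K2"
        by (rule K1[rule_format]; use B C in auto) (rule K2[rule_format]; use B C AM in auto)
      ultimately show False using C(3) by simp
    qed
    then show ?thesis
    proof
      assume "bad B" then show ?thesis using B by (intro exI[of _ B]) auto
    next
      assume "bad (A - B)" then show ?thesis using B AB by (intro exI[of _ "A - B"]) auto
    qed
  qed
  moreover have "bad (space M)"
    using unbounded unfolding bad_def by (metis not_le sets.sets_into_space sets.top)
  ultimately have "\<exists>A. \<forall>n. bad (A n) \<and> (A (Suc n) \<subseteq> A n \<and> real n \<le> \<bar>\<nu> (A (Suc n))\<bar>)"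
    by (intro dependent_nat_choice) auto
  then obtain A where "\<forall>n. bad (A n) \<and> (A (Suc n) \<subseteq> A n \<and> real n \<le> \<bar>\<nu> (A (Suc n))\<bar>)" ..
  then have A: "\<And>n. bad (A n)" "\<And>n. A (Suc n) \<subseteq> A n" "\<And>n. real n \<le> \<bar>\<nu> (A (Suc n))\<bar>"
    by simp_all
  have AM: "A n \<in> sets M" for n using A(1) by (simp add: bad_def)
  have A0: "A n \<subseteq> A 0" for n by (induction n) (use A(2) in auto)
  \<comment> \<open>Complements turn the decreasing sequence into an increasing one, whose
    successive differences are disjoint.\<close>
  define B where "B n = A 0 - A n" for n
  have BM: "B n \<in> sets M" for n using AM by (simp add: B_def)
  have Bmono: "B n \<subseteq> B (Suc n)" for n using A(2) by (auto simp: B_def)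
  have \<nu>B: "\<nu> (B n) = \<nu> (A 0) - \<nu> (A n)" for n
    unfolding B_def by (intro signed_measure_Diff[OF \<nu>] AM A0)
  have "(\<lambda>n. \<nu> (B (Suc n) - B n)) sums \<nu> (\<Union>n. B (Suc n) - B n)"
    using BM Bmono by (intro signed_measureD[OF \<nu>] disjoint_family_Suc) auto
  then have "(\<lambda>N. \<Sum>n<N. \<nu> (B (Suc n)) - \<nu> (B n)) \<longlonglongrightarrow> \<nu> (\<Union>n. B (Suc n) - B n)"
    unfolding sums_def using signed_measure_Diff[OF \<nu> BM BM Bmono] by simp
  then have "Bseq (\<lambda>N. \<Sum>n<N. \<nu> (B (Suc n)) - \<nu> (B n))"
    by (intro convergent_imp_Bseq convergentI)
  then obtain K where K: "\<And>N. \<bar>\<nu> (B N) - \<nu> (B 0)\<bar> \<le> K"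
    unfolding Bseq_def by (auto simp: sum_lessThan_telescope[of "\<lambda>n. \<nu> (B n)"])
  obtain n where "K + \<bar>\<nu> (A 0)\<bar> < real n" using reals_Archimedean2 by blast
  then show False using K[of "Suc n"] A(3)[of n] by (simp add: \<nu>B)
qed

section \<open>The Jordan decomposition\<close>

lemma ennreal_sum_le: "ennreal (\<Sum>i\<in>I. f i) \<le> (\<Sum>i\<in>I. ennreal (f i))"
proof -
  have "ennreal (\<Sum>i\<in>I. f i) \<le> ennreal (\<Sum>i\<in>I. max 0 (f i))"
    by (intro ennreal_leI sum_mono) simp
  also have "\<dots> = (\<Sum>i\<in>I. ennreal (max 0 (f i)))"
    by (rule sum_ennreal[symmetric]) simp
  finally show ?thesis by (simp add: ennreal_max_0)
qed

lemma sets_jordan_pos [simp, measurable_cong]: "sets (jordan_pos M \<nu>) = sets M"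
  and space_jordan_pos [simp]: "space (jordan_pos M \<nu>) = space M"
  unfolding jordan_pos_def by simp_all

text \<open>\<open>measure_of\<close> returns the prescribed values only if these are countably
  additive. One inequality follows from superadditivity on disjoint sets and monotonicity, the other
  by cutting a competitor \<open>B\<close> along the sets \<open>A n\<close>.\<close>

lemma emeasure_jordan_pos:
  fixes \<nu> :: "'a set \<Rightarrow> real"
  assumes \<nu>: "signed_measure M \<nu>" and A: "A \<in> sets M"
  shows "emeasure (jordan_pos M \<nu>) A = (SUP B\<in>{B \<in> sets M. B \<subseteq> A}. ennreal (\<nu> B))"
proof -
  define p where "p A = (SUP B\<in>{B \<in> sets M. B \<subseteq> A}. ennreal (\<nu> B))" for A
  have p_upper: "ennreal (\<nu> B) \<le> p A" if "B \<in> sets M" "B \<subseteq> A" for A B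
    unfolding p_def using that by (intro SUP_upper) auto
  have p_mono: "p A \<le> p B" if "A \<subseteq> B" for A B
    unfolding p_def using that by (intro SUP_subset_mono) auto
  have p_empty: "p {} = 0"
  proof -
    have "p {} \<le> 0"
      unfolding p_def by (rule SUP_least) (auto simp: signed_measure_empty[OF \<nu>])
    then show ?thesis by simp
  qed
  have p_add: "p A + p B \<le> p (A \<union> B)" if "A \<inter> B = {}" for A B
  proof -
    have *: "ennreal (\<nu> A') + ennreal (\<nu> B') \<le> p (A \<union> B)"
      if "A' \<in> sets M" "A' \<subseteq> A" "B' \<in> sets M" "B' \<subseteq> B" for A' B'
    proof -
      \<comment> \<open>\<open>ennreal\<close> turns negative values into 0, the value of the empty
        set. After this replacement both values are nonnegative and \<open>ennreal\<close> is
        additive on them.\<close>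
      define A'' where "A'' = (if \<nu> A' \<ge> 0 then A' else {})"
      define B'' where "B'' = (if \<nu> B' \<ge> 0 then B' else {})"
      have nn: "\<nu> A'' \<ge> 0" "\<nu> B'' \<ge> 0" "ennreal (\<nu> A') = ennreal (\<nu> A'')" "ennreal (\<nu> B') = ennreal (\<nu> B'')"
        by (auto simp: A''_def B''_def signed_measure_empty[OF \<nu>] ennreal_neg)
      have sub: "A'' \<in> sets M" "B'' \<in> sets M" "A'' \<subseteq> A" "B'' \<subseteq> B"
        using that by (auto simp: A''_def B''_def)
      have "ennreal (\<nu> A') + ennreal (\<nu> B') = ennreal (\<nu> (A'' \<union> B''))"
        using nn sub \<open>A \<inter> B = {}\<close> by (subst signed_measure_Un[OF \<nu>]) auto
      also have "\<dots> \<le> p (A \<union> B)" using sub by (intro p_upper) auto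
      finally show ?thesis .
    qed
    have ne: "{C \<in> sets M. C \<subseteq> D} \<noteq> {}" for D by auto
    have "p A + p B = (SUP A'\<in>{C \<in> sets M. C \<subseteq> A}. ennreal (\<nu> A') + p B)"
      unfolding p_def[of A] by (rule ennreal_SUP_add_left[OF ne, symmetric])
    also have "\<dots> \<le> p (A \<union> B)"
    proof (rule SUP_least)
      fix A' assume A': "A' \<in> {C \<in> sets M. C \<subseteq> A}"
      have "ennreal (\<nu> A') + p B = (SUP B'\<in>{C \<in> sets M. C \<subseteq> B}. ennreal (\<nu> A') + ennreal (\<nu> B'))"
        unfolding p_def[of B] by (rule ennreal_SUP_add_right[OF ne])
      also have "\<dots> \<le> p (A \<union> B)" using A' * by (intro SUP_least) auto
      finally show "ennreal (\<nu> A') + p B \<le> p (A \<union> B)" .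
    qed
    finally show ?thesis .
  qed
  have "countably_additive (sets M) p"
  proof (rule countably_additiveI)
    fix A :: "nat \<Rightarrow> 'a set"
    assume A: "range A \<subseteq> sets M" "disjoint_family A" "(\<Union>n. A n) \<in> sets M"
    show "(\<Sum>n. p (A n)) = p (\<Union>n. A n)"
    proof (rule antisym)
      have fin: "(\<Sum>n<N. p (A n)) \<le> p (\<Union>n<N. A n)" for N
      proof (induction N)
        case (Suc N)
        have "A n \<inter> A N = {}" if "n < N" for n
          using that by (intro disjoint_family_onD[OF A(2)]) auto
        then have "(\<Union>n<N. A n) \<inter> A N = {}" by blast
        then have "p (\<Union>n<N. A n) + p (A N) \<le> p ((\<Union>n<N. A n) \<union> A N)" by (rule p_add)
        moreover have "(\<Union>n<N. A n) \<union> A N = (\<Union>n<Suc N. A n)" by (auto simp: lessThan_Suc)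
        ultimately show ?case
          unfolding sum.lessThan_Suc by (metis (no_types) Suc add_right_mono order_trans)
      qed (simp add: p_empty)
      show "(\<Sum>n. p (A n)) \<le> p (\<Union>n. A n)"
        unfolding suminf_eq_SUP by (intro SUP_least order_trans[OF fin] p_mono) auto
      show "p (\<Union>n. A n) \<le> (\<Sum>n. p (A n))"
        unfolding p_def[of "\<Union>n. A n"]
      proof (rule SUP_least, clarify)
        fix B assume B: "B \<in> sets M" "B \<subseteq> (\<Union>n. A n)"
        have "(\<lambda>n. \<nu> (B \<inter> A n)) sums \<nu> (\<Union>n. B \<inter> A n)"
          using A B by (intro signed_measureD[OF \<nu>]) (auto simp: disjoint_family_on_def)
        moreover have "(\<Union>n. B \<inter> A n) = B" using B by auto
        ultimately have "(\<lambda>N. ennreal (\<Sum>n<N. \<nu> (B \<inter> A n))) \<longlonglongrightarrow> ennreal (\<nu> B)"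
          by (simp add: sums_def)
        moreover have "ennreal (\<Sum>n<N. \<nu> (B \<inter> A n)) \<le> (\<Sum>n. p (A n))" for N
        proof -
          have "ennreal (\<Sum>n<N. \<nu> (B \<inter> A n)) \<le> (\<Sum>n<N. ennreal (\<nu> (B \<inter> A n)))"
            by (rule ennreal_sum_le)
          also have "\<dots> \<le> (\<Sum>n<N. p (A n))"
            using A B by (intro sum_mono p_upper) auto
          also have "\<dots> \<le> (\<Sum>n. p (A n))" by (rule sum_le_suminf) auto
          finally show ?thesis .
        qed
        ultimately show "ennreal (\<nu> B) \<le> (\<Sum>n. p (A n))"
          by (intro LIMSEQ_le_const2) auto
      qed
    qed
  qed
  moreover have "jordan_pos M \<nu> = measure_of (space M) (sets M) p"
    by (simp add: jordan_pos_def p_def[abs_def])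
  ultimately have "emeasure (jordan_pos M \<nu>) A = p A"
    using A by (intro emeasure_measure_of) (auto simp: positive_def p_empty dest: sets.sets_into_space)
  then show ?thesis by (simp add: p_def)
qed

lemma finite_measure_jordan_pos:
  assumes \<nu>: "signed_measure M \<nu>"
  shows "finite_measure (jordan_pos M \<nu>)"
proof
  obtain K where K: "\<And>A. A \<in> sets M \<Longrightarrow> \<bar>\<nu> A\<bar> \<le> K" using signed_measure_bounded[OF \<nu>] by blast
  have "emeasure (jordan_pos M \<nu>) (space M) \<le> ennreal K"
    using K by (subst emeasure_jordan_pos[OF \<nu>]) (auto intro!: SUP_least ennreal_leI simp: abs_le_iff)
  then show "emeasure (jordan_pos M \<nu>) (space (jordan_pos M \<nu>)) \<noteq> \<infinity>"
    by (auto simp: top_unique)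
qed

lemma le_measure_jordan_pos:
  assumes \<nu>: "signed_measure M \<nu>" and "A \<in> sets M" "B \<in> sets M" "B \<subseteq> A"
  shows "\<nu> B \<le> measure (jordan_pos M \<nu>) A"
proof -
  interpret finite_measure "jordan_pos M \<nu>" using \<nu> by (rule finite_measure_jordan_pos)
  have "ennreal (\<nu> B) \<le> emeasure (jordan_pos M \<nu>) A"
    using assms by (subst emeasure_jordan_pos[OF \<nu>]) (auto intro!: SUP_upper)
  then show ?thesis by (simp add: emeasure_eq_measure)
qed

lemma measure_jordan_pos_le:
  assumes \<nu>: "signed_measure M \<nu>" and "A \<in> sets M"
    and K: "\<And>B. B \<in> sets M \<Longrightarrow> B \<subseteq> A \<Longrightarrow> \<nu> B \<le> K"
  shows "measure (jordan_pos M \<nu>) A \<le> K"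
proof -
  interpret finite_measure "jordan_pos M \<nu>" using \<nu> by (rule finite_measure_jordan_pos)
  have "0 \<le> K" using K[of "{}"] signed_measure_empty[OF \<nu>] by simp
  moreover have "emeasure (jordan_pos M \<nu>) A \<le> ennreal K"
    using assms by (subst emeasure_jordan_pos[OF \<nu>]) (auto intro!: SUP_least ennreal_leI)
  ultimately show ?thesis by (simp add: emeasure_eq_measure)
qed

text \<open>No Hahn decomposition is involved: \<nu> B = \<nu> A - \<nu> (A - B) is at most \<nu> A
  plus the negative part of A, and the supremum over B gives one inequality. The other one is the
  same for -\<nu>.\<close>

lemma jordan_decomposition:
  assumes \<nu>: "signed_measure M \<nu>" and A: "A \<in> sets M"
  shows "\<nu> A = measure (jordan_pos M \<nu>) A - measure (jordan_pos M (\<lambda>A. - \<nu> A)) A"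
proof -
  have *: "measure (jordan_pos M \<nu>) A \<le> \<nu> A + measure (jordan_pos M (\<lambda>A. - \<nu> A)) A"
    if \<nu>: "signed_measure M \<nu>" for \<nu>
  proof (rule measure_jordan_pos_le[OF that A])
    fix B assume B: "B \<in> sets M" "B \<subseteq> A"
    have "- \<nu> (A - B) \<le> measure (jordan_pos M (\<lambda>A. - \<nu> A)) A"
      using A B by (intro le_measure_jordan_pos[OF signed_measure_uminus[OF \<nu>]]) auto
    then show "\<nu> B \<le> \<nu> A + measure (jordan_pos M (\<lambda>A. - \<nu> A)) A"
      using signed_measure_Diff[OF \<nu> B(1) A B(2)] by simp
  qed
  show ?thesis
    using *[OF \<nu>] *[OF signed_measure_uminus[OF \<nu>]] by simp
qed

section \<open>The circle\<close>

definition cis_in :: "quat \<Rightarrow> real \<Rightarrow> quat" where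
  "cis_in i \<theta> = of_real (cos \<theta>) + of_real (sin \<theta>) * i"

lemma imag_units_inner:
  assumes "i \<in> imag_units"
  shows "inner i i = 1" "inner 1 i = 0" "inner i 1 = 0" "inner (1::quat) 1 = 1"
proof -
  have "qRe i = 0" "inner i i = 1" using assms by (simp_all add: imag_units_def norm_eq_1)
  then show "inner i i = 1" "inner 1 i = 0" "inner i 1 = 0" "inner (1::quat) 1 = 1"
    by (simp_all add: inner_quat_def)
qed

lemma imag_units_square:
  assumes "i \<in> imag_units"
  shows "i * i = - 1"
proof -
  have "qRe i = 0" using assms by (simp add: imag_units_def)
  moreover from this have "qI i * qI i + qJ i * qJ i + qK i * qK i = 1"
    using imag_units_inner(1)[OF assms] by (simp add: inner_quat_def)
  ultimately show ?thesis by (simp add: quat_eq_iff)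
qed

lemma cis_in_scaleR: "cis_in i \<theta> = cos \<theta> *\<^sub>R 1 + sin \<theta> *\<^sub>R i"
  by (simp add: cis_in_def scaleR_conv_of_real)

lemma qRe_cis_in: "i \<in> imag_units \<Longrightarrow> qRe (cis_in i \<theta>) = cos \<theta>"
  by (simp add: cis_in_scaleR imag_units_def)

lemma inner_cis_in: "i \<in> imag_units \<Longrightarrow> inner i (cis_in i \<theta>) = sin \<theta>"
  by (simp add: cis_in_scaleR inner_add_right imag_units_inner)

lemma cis_in_add:
  assumes "i \<in> imag_units"
  shows "cis_in i (a + b) = cis_in i a * cis_in i b"
proof -
  have "cis_in i a * cis_in i b = of_real (cos a * cos b) + of_real (sin a * cos b + cos a * sin b) * i
      + of_real (sin a * sin b) * (i * i)"
    by (simp add: cis_in_def of_real_def algebra_simps)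
  also have "\<dots> = cis_in i (a + b)"
    by (simp add: imag_units_square[OF assms] cis_in_def cos_add sin_add of_real_diff algebra_simps)
  finally show ?thesis ..
qed

lemma cis_in_0 [simp]: "cis_in i 0 = 1"
  by (simp add: cis_in_def)

lemma cis_in_power: "i \<in> imag_units \<Longrightarrow> cis_in i \<theta> ^ n = cis_in i (real n * \<theta>)"
  by (induction n) (simp_all add: cis_in_add[symmetric] distrib_right)

lemma cis_in_powi:
  assumes "i \<in> imag_units"
  shows "cis_in i \<theta> powi n = cis_in i (of_int n * \<theta>)"
proof (cases "n \<ge> 0")
  case True
  then show ?thesis by (simp add: power_int_def cis_in_power[OF assms])
next
  case False
  have "cis_in i a * cis_in i (- a) = 1" for a using cis_in_add[OF assms, of a "- a"] by simp
  then have "inverse (cis_in i a) = cis_in i (- a)" for a by (metis inverse_unique)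
  then show ?thesis using False by (simp add: power_int_def cis_in_power[OF assms])
qed

lemma norm_slice_eq: "i \<in> imag_units \<Longrightarrow> norm (of_real a + of_real b * i) = sqrt (a\<^sup>2 + b\<^sup>2)"
  by (simp add: norm_eq_sqrt_inner scaleR_conv_of_real[symmetric] of_real_def inner_add_left
      inner_add_right imag_units_inner power2_eq_square)

lemma slice_circle_eq:
  assumes "i \<in> imag_units"
  shows "slice_circle i = cis_in i ` {0..<2 * pi}"
proof (intro equalityI subsetI)
  fix p assume "p \<in> slice_circle i"
  then obtain a b where p: "p = of_real a + of_real b * i" "norm p = 1"
    by (auto simp: slice_circle_def slice_def)
  then have "a\<^sup>2 + b\<^sup>2 = 1" by (simp add: norm_slice_eq[OF assms])
  then obtain t where "0 \<le> t" "t < 2 * pi" "a = cos t" "b = sin t" by (rule sincos_total_2pi)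
  then show "p \<in> cis_in i ` {0..<2 * pi}" by (auto simp: p cis_in_def)
next
  fix p assume "p \<in> cis_in i ` {0..<2 * pi}"
  then show "p \<in> slice_circle i"
    by (auto simp: slice_circle_def slice_def cis_in_def norm_slice_eq[OF assms])
qed

lemma cis_in_mem: "i \<in> imag_units \<Longrightarrow> cis_in i \<theta> \<in> slice_circle i"
  by (auto simp: slice_circle_def slice_def cis_in_def norm_slice_eq)

lemma continuous_on_cis_in: "continuous_on A (cis_in i)"
  unfolding cis_in_def by (intro continuous_intros)

lemma compact_slice_circle:
  assumes "i \<in> imag_units"
  shows "compact (slice_circle i)"
proof -
  have "slice_circle i = cis_in i ` {0..2 * pi}"
    using slice_circle_eq[OF assms] cis_in_mem[OF assms] by fastforce
  then show ?thesis by (simp add: compact_continuous_image continuous_on_cis_in)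
qed

lemma space_circle_borel [simp]: "space (circle_borel i) = slice_circle i"
  by (simp add: circle_borel_def space_restrict_space)

text \<open>The circle is closed, so traces of closed sets are its closed subsets. They form the
  intersection-stable generator for the later Dynkin argument.\<close>

lemma sets_circle_borel:
  assumes "i \<in> imag_units"
  shows "sets (circle_borel i) = sigma_sets (slice_circle i) {A. closed A \<and> A \<subseteq> slice_circle i}"
proof -
  have "(\<inter>) (slice_circle i) ` sigma_sets UNIV (Collect closed)
      = sigma_sets (slice_circle i) ((\<inter>) (slice_circle i) ` Collect closed)"
    by (rule sigma_sets_Int) (auto simp: borel_eq_closed[symmetric] sets_measure_of[symmetric]
      intro!: borel_closed compact_imp_closed compact_slice_circle[OF assms])
  moreover have "(\<inter>) (slice_circle i) ` Collect closed = {A. closed A \<and> A \<subseteq> slice_circle i}"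
    using compact_imp_closed[OF compact_slice_circle[OF assms]] by (auto simp: image_iff)
  ultimately show ?thesis
    by (simp add: circle_borel_def sets_restrict_space borel_eq_closed)
qed

lemma integrable_continuous_circle:
  fixes f :: "quat \<Rightarrow> 'b::euclidean_space"
  assumes i: "i \<in> imag_units" and P: "finite_measure P" "sets P = sets (circle_borel i)"
    and f: "continuous_on (slice_circle i) f"
  shows "integrable P f"
proof -
  interpret finite_measure P by fact
  have sp: "space P = slice_circle i" using sets_eq_imp_space_eq[OF P(2)] by simp
  obtain B where B: "\<And>x. x \<in> slice_circle i \<Longrightarrow> norm (f x) \<le> B"
    using compact_imp_bounded[OF compact_continuous_image[OF f compact_slice_circle[OF i]]]
    by (auto simp: bounded_iff)
  have "f \<in> borel_measurable (circle_borel i)"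
    unfolding circle_borel_def using f by (rule borel_measurable_continuous_on_restrict)
  then have "f \<in> borel_measurable P" using measurable_cong_sets[OF P(2) refl] by blast
  then show ?thesis
    by (rule integrable_const_bound[of _ B, rotated]) (auto intro!: AE_I2 B simp: sp)
qed

lemma integrable_continuous_mult_circle:
  fixes w :: "quat \<Rightarrow> 'b::euclidean_space"
  assumes i: "i \<in> imag_units" and P: "sets P = sets (circle_borel i)"
    and f: "continuous_on (slice_circle i) (f :: quat \<Rightarrow> real)" and w: "integrable P w"
  shows "integrable P (\<lambda>p. f p *\<^sub>R w p)"
proof -
  have sp: "space P = slice_circle i" using sets_eq_imp_space_eq[OF P] by simp
  obtain B where B: "\<And>x. x \<in> slice_circle i \<Longrightarrow> norm (f x) \<le> B"
    using compact_imp_bounded[OF compact_continuous_image[OF f compact_slice_circle[OF i]]]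
    by (auto simp: bounded_iff)
  have "f \<in> borel_measurable (circle_borel i)"
    unfolding circle_borel_def using f by (rule borel_measurable_continuous_on_restrict)
  then have [measurable]: "f \<in> borel_measurable P" using measurable_cong_sets[OF P refl] by blast
  have [measurable]: "w \<in> borel_measurable P" using w by auto
  show ?thesis
  proof (rule Bochner_Integration.integrable_bound)
    show "integrable P (\<lambda>p. B *\<^sub>R w p)" using w by simp
    show "AE p in P. norm (f p *\<^sub>R w p) \<le> norm (B *\<^sub>R w p)"
      using B by (intro AE_I2) (fastforce simp: sp intro!: mult_right_mono)
  qed simp
qed

section \<open>Trigonometric polynomials\<close>

text \<open>Real trigonometric polynomials without an angle: at e^(it) the two kinds of generators
  are cos(nt) and sin(nt). \<open>trig_cong\<close> reflects that only the values on the circle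
  matter.\<close>

inductive trig :: "quat \<Rightarrow> (quat \<Rightarrow> real) \<Rightarrow> bool" for i where
  trig_cos: "trig i (\<lambda>p. qRe (p powi n))"
| trig_sin: "trig i (\<lambda>p. inner i (p powi n))"
| trig_add: "trig i f \<Longrightarrow> trig i g \<Longrightarrow> trig i (\<lambda>p. f p + g p)"
| trig_scale: "trig i f \<Longrightarrow> trig i (\<lambda>p. r * f p)"
| trig_cong: "trig i f \<Longrightarrow> (\<And>p. p \<in> slice_circle i \<Longrightarrow> f p = g p) \<Longrightarrow> trig i g"

lemma circle_powi:
  assumes "i \<in> imag_units" "p \<in> slice_circle i"
  obtains t where "\<And>n. qRe (p powi n) = cos (of_int n * t)" "\<And>n. inner i (p powi n) = sin (of_int n * t)"
  using assms by (auto simp: slice_circle_eq cis_in_powi qRe_cis_in inner_cis_in)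

lemma powi_decompose:
  assumes "i \<in> imag_units" "p \<in> slice_circle i"
  shows "p powi n = of_real (qRe (p powi n)) + of_real (inner i (p powi n)) * i"
proof -
  obtain t where "p = cis_in i t" using assms by (auto simp: slice_circle_eq)
  then show ?thesis
    using assms(1) by (simp add: cis_in_powi qRe_cis_in inner_cis_in) (simp add: cis_in_def)
qed

lemma continuous_on_powi_circle: "continuous_on (slice_circle i) (\<lambda>p. p powi n)"
  by (intro continuous_intros) (auto simp: slice_circle_def)

lemma bounded_linear_qRe: "bounded_linear qRe"
proof -
  have "qRe = (\<lambda>q. inner 1 q)" by (simp add: fun_eq_iff inner_quat_def)
  then show ?thesis by (metis bounded_linear_inner_right)
qed

lemma continuous_on_qRe_powi: "continuous_on (slice_circle i) (\<lambda>p. qRe (p powi n))"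
  by (rule bounded_linear.continuous_on[OF bounded_linear_qRe continuous_on_powi_circle])

lemma continuous_on_inner_powi: "continuous_on (slice_circle i) (\<lambda>p. inner i (p powi n))"
  by (intro continuous_on_inner continuous_on_const continuous_on_powi_circle)

lemma trig_continuous: "trig i f \<Longrightarrow> continuous_on (slice_circle i) f"
proof (induction rule: trig.induct)
  case (trig_cong f g)
  then show ?case by (simp cong: continuous_on_cong)
qed (intro continuous_on_qRe_powi continuous_on_inner_powi continuous_intros | assumption)+

text \<open>Product-to-sum formulas settle the generators, and an induction on each factor extends
  this to all products, as Stone-Weierstrass requires.\<close>

lemma trig_mult:
  assumes i: "i \<in> imag_units" and "trig i f" "trig i g"
  shows "trig i (\<lambda>p. f p * g p)"
proof -
  have half: "trig i (\<lambda>p. 1 / 2 * f p + r * g p)" if "trig i f" "trig i g" for f g and r :: real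
    by (rule trig_add[OF trig_scale[OF that(1)] trig_scale[OF that(2)]])
  have cc: "trig i (\<lambda>p. qRe (p powi n) * qRe (p powi m))" for n m
    by (rule trig_cong[OF half[OF trig_cos[of i "n + m"] trig_cos[of i "n - m"], of "1 / 2"]],
        erule circle_powi[OF i]) (simp add: cos_add cos_diff algebra_simps)
  have cs: "trig i (\<lambda>p. qRe (p powi n) * inner i (p powi m))" for n m
    by (rule trig_cong[OF half[OF trig_sin[of i "n + m"] trig_sin[of i "n - m"], of "- 1 / 2"]],
        erule circle_powi[OF i]) (simp add: sin_add sin_diff algebra_simps)
  have sc: "trig i (\<lambda>p. inner i (p powi n) * qRe (p powi m))" for n m
    by (rule trig_cong[OF cs]) (rule mult.commute)
  have ss: "trig i (\<lambda>p. inner i (p powi n) * inner i (p powi m))" for n m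
    by (rule trig_cong[OF half[OF trig_cos[of i "n - m"] trig_cos[of i "n + m"], of "- 1 / 2"]],
        erule circle_powi[OF i]) (simp add: cos_add cos_diff algebra_simps)
  have *: "trig i (\<lambda>p. f p * g p)"
    if "trig i g" "\<And>n. trig i (\<lambda>p. f p * qRe (p powi n))" "\<And>n. trig i (\<lambda>p. f p * inner i (p powi n))" for f g
    using that(1)
  proof (induction rule: trig.induct)
    case (trig_add g h)
    then show ?case using trig.trig_add[of i "\<lambda>p. f p * g p" "\<lambda>p. f p * h p"] by (simp add: distrib_left)
  next
    case (trig_scale g r)
    then show ?case using trig.trig_scale[of i "\<lambda>p. f p * g p" r] by (simp add: mult.left_commute)
  next
    case (trig_cong g h)
    then show ?case by (elim trig.trig_cong) simp
  qed (use that in auto)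
  show ?thesis using assms(2)
  proof (induction rule: trig.induct)
    case (trig_cos n)
    show ?case by (rule *[OF assms(3) cc cs])
  next
    case (trig_sin n)
    show ?case by (rule *[OF assms(3) sc ss])
  next
    case (trig_add f h)
    then show ?case using trig.trig_add[of i "\<lambda>p. f p * g p" "\<lambda>p. h p * g p"] by (simp add: distrib_right)
  next
    case (trig_scale f r)
    then show ?case using trig.trig_scale[of i "\<lambda>p. f p * g p" r] by (simp add: mult.assoc)
  next
    case (trig_cong f h)
    then show ?case by (elim trig.trig_cong) simp
  qed
qed

text \<open>Stone-Weierstrass: exponent 0 supplies the constants, and exponent 1 separates points,
  since its two parts recover the point.\<close>

lemma trig_dense:
  assumes i: "i \<in> imag_units" and f: "continuous_on (slice_circle i) f" and e: "0 < e"
  obtains g where "trig i g" "\<And>p. p \<in> slice_circle i \<Longrightarrow> \<bar>f p - g p\<bar> < e"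
proof -
  have "\<exists>g. trig i g \<and> (\<forall>p\<in>slice_circle i. \<bar>f p - g p\<bar> < e)"
  proof (rule Stone_Weierstrass_HOL[OF compact_slice_circle[OF i] _ trig_continuous _ _ _ f e])
    fix c :: real
    show "trig i (\<lambda>x. c)"
      using trig_scale[OF trig_cos[of i 0], of c] by simp
  next
    fix x y assume xy: "x \<in> slice_circle i \<and> y \<in> slice_circle i \<and> x \<noteq> y"
    show "\<exists>f. trig i f \<and> f x \<noteq> f y"
    proof (rule ccontr)
      assume "\<nexists>f. trig i f \<and> f x \<noteq> f y"
      then have "qRe (x powi 1) = qRe (y powi 1)" "inner i (x powi 1) = inner i (y powi 1)"
        using trig_cos[of i 1] trig_sin[of i 1] by blast+
      then have "x powi 1 = y powi 1"
        using xy powi_decompose[OF i, of x 1] powi_decompose[OF i, of y 1] by metis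
      then show False using xy by simp
    qed
  qed (use trig_add trig_mult[OF i] in auto)
  then show ?thesis using that by blast
qed

section \<open>Uniqueness of the moment problem\<close>

text \<open>The difference \<open>L\<close> of the two sides vanishes on trigonometric polynomials
  and is bounded by the total mass \<open>K\<close> times the supremum norm, hence vanishes on
  uniform limits.\<close>

lemma circle_continuous_determined:
  fixes P N m :: "quat measure" and w :: "quat \<Rightarrow> real"
  assumes i: "i \<in> imag_units"
    and P: "finite_measure P" "sets P = sets (circle_borel i)"
    and N: "finite_measure N" "sets N = sets (circle_borel i)"
    and m: "sets m = sets (circle_borel i)" and w: "integrable m w"
    and cos: "\<And>n. (\<integral>p. qRe (p powi n) \<partial>P) - (\<integral>p. qRe (p powi n) \<partial>N) = (\<integral>p. qRe (p powi n) * w p \<partial>m)"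
    and sin: "\<And>n. (\<integral>p. inner i (p powi n) \<partial>P) - (\<integral>p. inner i (p powi n) \<partial>N) = (\<integral>p. inner i (p powi n) * w p \<partial>m)"
    and f: "continuous_on (slice_circle i) f"
  shows "(\<integral>p. f p \<partial>P) - (\<integral>p. f p \<partial>N) = (\<integral>p. f p * w p \<partial>m)"
proof -
  interpret P: finite_measure P by fact
  interpret N: finite_measure N by fact
  define L where "L f = (\<integral>p. f p \<partial>P) - (\<integral>p. f p \<partial>N) - (\<integral>p. f p * w p \<partial>m)" for f
  have sp: "space P = slice_circle i" "space N = slice_circle i" "space m = slice_circle i"
    using sets_eq_imp_space_eq[OF P(2)] sets_eq_imp_space_eq[OF N(2)] sets_eq_imp_space_eq[OF m] by simp_all
  have int: "integrable P f" "integrable N f" "integrable m (\<lambda>p. f p * w p)"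
    if "continuous_on (slice_circle i) f" for f :: "quat \<Rightarrow> real"
    using integrable_continuous_circle[OF i P that] integrable_continuous_circle[OF i N that]
      integrable_continuous_mult_circle[OF i m that w] by simp_all
  have L_trig: "L g = 0" if "trig i g" for g
    using that
  proof (induction rule: trig.induct)
    case (trig_cos n)
    show ?case using cos[of n] by (simp add: L_def)
  next
    case (trig_sin n)
    show ?case using sin[of n] by (simp add: L_def)
  next
    case (trig_add f g)
    then show ?case
      using int[OF trig_continuous[OF trig_add(1)]] int[OF trig_continuous[OF trig_add(2)]]
      by (simp add: L_def distrib_right)
  next
    case (trig_scale f r)
    then show ?case by (simp add: L_def mult.assoc right_diff_distrib[symmetric])
  next
    case (trig_cong f g)
    have "L g = L f"
      unfolding L_def using trig_cong(2) sp
      by (intro arg_cong2[where f = "(-)"] Bochner_Integration.integral_cong) auto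
    then show ?case using trig_cong by simp
  qed
  define K where "K = measure P (space P) + measure N (space N) + (\<integral>p. \<bar>w p\<bar> \<partial>m)"
  have K: "K \<ge> 0" by (simp add: K_def)
  have "\<bar>L f\<bar> \<le> e * K" if e: "e > 0" for e
  proof -
    obtain g where g: "trig i g" "\<And>p. p \<in> slice_circle i \<Longrightarrow> \<bar>f p - g p\<bar> < e"
      using trig_dense[OF i f e] by blast
    note gc = trig_continuous[OF g(1)]
    define h where "h p = f p - g p" for p
    have h: "continuous_on (slice_circle i) h" unfolding h_def by (intro continuous_intros f gc)
    have he: "\<bar>h p\<bar> \<le> e" if "p \<in> slice_circle i" for p using g(2)[OF that] by (simp add: h_def)
    have "L f = L f - L g" using L_trig[OF g(1)] by simp
    also have "\<dots> = L h"
      using int[OF f] int[OF gc] by (simp add: L_def h_def left_diff_distrib)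
    finally have "\<bar>L f\<bar> \<le> \<bar>\<integral>p. h p \<partial>P\<bar> + \<bar>\<integral>p. h p \<partial>N\<bar> + \<bar>\<integral>p. h p * w p \<partial>m\<bar>"
      by (simp add: L_def)
    also have "\<dots> \<le> e * measure P (space P) + e * measure N (space N) + (\<integral>p. e * \<bar>w p\<bar> \<partial>m)"
    proof (intro add_mono)
      show "\<bar>\<integral>p. h p \<partial>P\<bar> \<le> e * measure P (space P)"
      proof -
        have "norm (\<integral>p. h p \<partial>P) \<le> (\<integral>p. e \<partial>P)"
          by (rule Bochner_Integration.integral_norm_bound_integral[OF int(1)[OF h] P.integrable_const])
            (simp add: he sp)
        then show ?thesis by (simp add: mult.commute)
      qed
      show "\<bar>\<integral>p. h p \<partial>N\<bar> \<le> e * measure N (space N)"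
      proof -
        have "norm (\<integral>p. h p \<partial>N) \<le> (\<integral>p. e \<partial>N)"
          by (rule Bochner_Integration.integral_norm_bound_integral[OF int(2)[OF h] N.integrable_const])
            (simp add: he sp)
        then show ?thesis by (simp add: mult.commute)
      qed
      have "norm (\<integral>p. h p * w p \<partial>m) \<le> (\<integral>p. e * \<bar>w p\<bar> \<partial>m)"
        using w by (intro Bochner_Integration.integral_norm_bound_integral[OF int(3)[OF h]])
          (auto simp: abs_mult sp intro!: mult_right_mono he)
      then show "\<bar>\<integral>p. h p * w p \<partial>m\<bar> \<le> (\<integral>p. e * \<bar>w p\<bar> \<partial>m)" by simp
    qed
    also have "\<dots> = e * K" by (simp add: K_def distrib_left)
    finally show ?thesis .
  qed
  note L_le = this
  have "\<bar>L f\<bar> \<le> 0 + e" if "e > 0" for e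
  proof -
    \<comment> \<open>The denominator \<open>K + 1\<close> avoids a division by zero.\<close>
    have "\<bar>L f\<bar> \<le> e / (K + 1) * K" using L_le[of "e / (K + 1)"] that K by simp
    also have "\<dots> \<le> e" using that K by (simp add: field_simps)
    finally show ?thesis by simp
  qed
  then have "\<bar>L f\<bar> \<le> 0" by (rule field_le_epsilon)
  then show ?thesis by (simp add: L_def)
qed

text \<open>The functions 1 - n dist(p, A), cut off at 0, decrease to the indicator of a closed set
  A; dominated convergence gives the claim there and a Dynkin argument extends it.\<close>

lemma circle_measure_determined:
  fixes P N m :: "quat measure" and w :: "quat \<Rightarrow> real"
  assumes i: "i \<in> imag_units"
    and P: "finite_measure P" "sets P = sets (circle_borel i)"
    and N: "finite_measure N" "sets N = sets (circle_borel i)"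
    and m: "sets m = sets (circle_borel i)" and w: "integrable m w"
    and eq: "\<And>f. continuous_on (slice_circle i) f \<Longrightarrow>
      (\<integral>p. f p \<partial>P) - (\<integral>p. f p \<partial>N) = (\<integral>p. f p * w p \<partial>m)"
    and A: "A \<in> sets (circle_borel i)"
  shows "measure P A - measure N A = (LINT p:A|m. w p)"
proof -
  interpret P: finite_measure P by fact
  interpret N: finite_measure N by fact
  let ?S = "slice_circle i"
  let ?G = "{A. closed A \<and> A \<subseteq> ?S}"
  have sp: "space P = ?S" "space N = ?S" "space m = ?S"
    using sets_eq_imp_space_eq[OF P(2)] sets_eq_imp_space_eq[OF N(2)] sets_eq_imp_space_eq[OF m] by simp_all
  have sets: "sets P = sigma_sets ?S ?G" "sets N = sigma_sets ?S ?G" "sets m = sigma_sets ?S ?G"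
    using P N m sets_circle_borel[OF i] by simp_all
  have wm [measurable]: "w \<in> borel_measurable m" using w by auto
  have set_int: "set_integrable m A w" if "A \<in> sets m" for A
    unfolding set_integrable_def using integrable_mult_indicator[OF that w] .
  \<comment> \<open>The empty set is treated apart, as \<open>infdist\<close> to it is 0 and the
    approximants would be constantly 1.\<close>
  have closed: "measure P A - measure N A = (LINT p:A|m. w p)" if A: "closed A" "A \<subseteq> ?S" "A \<noteq> {}" for A
  proof -
    define f where "f n p = max 0 (1 - real n * infdist p A)" for n p
    have fc: "continuous_on ?S (f n)" for n
      unfolding f_def by (intro continuous_intros)
    have f_ind: "f n p = 1" if "p \<in> A" for n p using that by (simp add: f_def)
    have f_lim: "(\<lambda>n. f n p) \<longlonglongrightarrow> indicator A p" for p
    proof (cases "p \<in> A")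
      case True
      then show ?thesis by (simp add: f_ind)
    next
      case False
      then have "infdist p A > 0"
        using A infdist_nonneg[of p A] in_closed_iff_infdist_zero[OF A(1,3)] by (metis less_eq_real_def)
      then obtain n0 where n0: "1 < real n0 * infdist p A" using reals_Archimedean3 by blast
      have "f n p = 0" if "n \<ge> n0" for n
      proof -
        have "real n0 * infdist p A \<le> real n * infdist p A"
          using that infdist_nonneg by (intro mult_right_mono) auto
        then show ?thesis using n0 by (simp add: f_def)
      qed
      then have "eventually (\<lambda>n. f n p = 0) sequentially" by (auto simp: eventually_sequentially)
      then show ?thesis using False by (simp add: tendsto_eventually)
    qed
    have f01: "\<bar>f n p\<bar> \<le> 1" for n p using infdist_nonneg[of p A] by (simp add: f_def)
    have AM: "A \<in> sigma_sets ?S ?G" using A by (intro sigma_sets.Basic) auto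
    have fm: "f n \<in> borel_measurable Q" if "sets Q = sets (circle_borel i)" for n and Q :: "quat measure"
    proof -
      have "f n \<in> borel_measurable (circle_borel i)"
        unfolding circle_borel_def using fc by (rule borel_measurable_continuous_on_restrict)
      then show ?thesis using measurable_cong_sets[OF that refl] by blast
    qed
    have lim: "(\<lambda>n. \<integral>p. f n p \<partial>Q) \<longlonglongrightarrow> measure Q A"
      if Q: "finite_measure Q" "sets Q = sets (circle_borel i)" for Q :: "quat measure"
    proof -
      interpret Q: finite_measure Q by fact
      have AQ: "A \<in> sets Q" using AM Q(2) sets_circle_borel[OF i] by simp
      have "(\<lambda>n. \<integral>p. f n p \<partial>Q) \<longlonglongrightarrow> (\<integral>p. indicator A p \<partial>Q)"
        using f01 by (intro integral_dominated_convergence[where w = "\<lambda>_. 1"] fm[OF Q(2)] AE_I2 f_lim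
            borel_measurable_indicator AQ Q.integrable_const) auto
      moreover have "A \<inter> space Q = A" using sets.sets_into_space[OF AQ] by auto
      ultimately show ?thesis by simp
    qed
    have "(\<lambda>n. \<integral>p. f n p * w p \<partial>m) \<longlonglongrightarrow> (\<integral>p. indicator A p * w p \<partial>m)"
    proof (rule integral_dominated_convergence[where w = "\<lambda>p. \<bar>w p\<bar>"])
      show "(\<lambda>p. indicator A p * w p) \<in> borel_measurable m"
        using AM sets by (intro borel_measurable_times borel_measurable_indicator wm) simp
      show "(\<lambda>p. f n p * w p) \<in> borel_measurable m" for n by (intro borel_measurable_times fm[OF m] wm)
      show "AE p in m. (\<lambda>n. f n p * w p) \<longlonglongrightarrow> indicator A p * w p"
        by (intro AE_I2 tendsto_mult f_lim tendsto_const)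
      show "AE p in m. norm (f n p * w p) \<le> \<bar>w p\<bar>" for n
        using f01[of n] by (intro AE_I2) (simp add: abs_mult mult_left_le_one_le)
    qed (use w in simp)
    moreover have "(\<lambda>n. (\<integral>p. f n p \<partial>P) - (\<integral>p. f n p \<partial>N)) \<longlonglongrightarrow> measure P A - measure N A"
      by (intro tendsto_diff lim P N)
    ultimately have "measure P A - measure N A = (\<integral>p. indicator A p * w p \<partial>m)"
      unfolding eq[OF fc] by (rule LIMSEQ_unique[rotated])
    then show ?thesis by (simp add: set_lebesgue_integral_def)
  qed
  have closed': "measure P A - measure N A = (LINT p:A|m. w p)" if "A \<in> ?G" for A
    using that closed[of A] by (cases "A = {}") (auto simp: set_lebesgue_integral_def)
  have S: "?S \<in> ?G" using compact_imp_closed[OF compact_slice_circle[OF i]] by simp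
  have "Int_stable ?G" by (auto simp: Int_stable_def)
  moreover have "?G \<subseteq> Pow ?S" by auto
  moreover have "A \<in> sigma_sets ?S ?G" using A sets_circle_borel[OF i] by simp
  ultimately show ?thesis
  proof (induction rule: sigma_sets_induct_disjoint)
    case (basic A)
    then show ?case by (rule closed')
  next
    case empty
    show ?case by (simp add: set_lebesgue_integral_def)
  next
    case (compl A)
    have AM: "A \<in> sets P" "A \<in> sets N" "A \<in> sets m" using compl sets by simp_all
    have SM: "?S \<in> sets m" using sp(3) sets.top by metis
    have "(LINT p:?S|m. w p) = (LINT p:(A \<union> (?S - A))|m. w p)"
      using sets.sets_into_space[OF AM(3)] sp by (simp add: Un_absorb1)
    also have "\<dots> = (LINT p:A|m. w p) + (LINT p:?S - A|m. w p)"
      using AM SM by (intro set_integral_Un set_int) auto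
    finally show ?case
      using compl closed'[OF S] P.finite_measure_compl[OF AM(1)] N.finite_measure_compl[OF AM(2)]
      by (simp add: sp)
  next
    case (union A)
    have AM: "range A \<subseteq> sets P" "range A \<subseteq> sets N" "range A \<subseteq> sets m"
      using union sets by auto
    have "(\<lambda>n. measure P (A n) - measure N (A n)) sums (measure P (\<Union>n. A n) - measure N (\<Union>n. A n))"
      using AM union by (intro sums_diff P.finite_measure_UNION N.finite_measure_UNION)
    then have "measure P (\<Union>n. A n) - measure N (\<Union>n. A n) = (\<Sum>n. LINT p:A n|m. w p)"
      using union by (simp add: sums_iff)
    also have "\<dots> = (LINT p:(\<Union>n. A n)|m. w p)"
      using AM union by (intro lebesgue_integral_countable_add[symmetric] set_int) (auto simp: disjoint_family_on_def)
    finally show ?case .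
  qed
qed

lemma integral_powi_circle:
  assumes i: "i \<in> imag_units" and P: "finite_measure P" "sets P = sets (circle_borel i)"
  shows "(\<integral>p. p powi n \<partial>P) = (\<integral>p. qRe (p powi n) \<partial>P) *\<^sub>R 1 + (\<integral>p. inner i (p powi n) \<partial>P) *\<^sub>R i"
proof -
  have sp: "space P = slice_circle i" using sets_eq_imp_space_eq[OF P(2)] by simp
  have "(\<integral>p. p powi n \<partial>P) = (\<integral>p. qRe (p powi n) *\<^sub>R 1 + inner i (p powi n) *\<^sub>R i \<partial>P)"
  proof (rule Bochner_Integration.integral_cong)
    fix p assume "p \<in> space P"
    then show "p powi n = qRe (p powi n) *\<^sub>R 1 + inner i (p powi n) *\<^sub>R i"
      using powi_decompose[OF i, of p n] by (simp add: sp scaleR_conv_of_real)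
  qed simp
  also have "\<dots> = (\<integral>p. qRe (p powi n) *\<^sub>R 1 \<partial>P) + (\<integral>p. inner i (p powi n) *\<^sub>R i \<partial>P)"
    by (intro Bochner_Integration.integral_add integrable_scaleR_left integrable_continuous_circle[OF i P]
        continuous_on_qRe_powi continuous_on_inner_powi)
  finally show ?thesis
    by (simp add: integrable_continuous_circle[OF i P continuous_on_qRe_powi]
        integrable_continuous_circle[OF i P continuous_on_inner_powi])
qed

lemma integral_powi_mult_circle:
  fixes w :: "quat \<Rightarrow> quat"
  assumes i: "i \<in> imag_units" and m: "sets m = sets (circle_borel i)" and w: "integrable m w"
  shows "(\<integral>p. p powi n * w p \<partial>m)
    = (\<integral>p. qRe (p powi n) *\<^sub>R w p \<partial>m) + i * (\<integral>p. inner i (p powi n) *\<^sub>R w p \<partial>m)"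
proof -
  have sp: "space m = slice_circle i" using sets_eq_imp_space_eq[OF m] by simp
  note int = integrable_continuous_mult_circle[OF i m continuous_on_qRe_powi w]
    integrable_continuous_mult_circle[OF i m continuous_on_inner_powi w]
  have "(\<integral>p. p powi n * w p \<partial>m) = (\<integral>p. qRe (p powi n) *\<^sub>R w p + i * (inner i (p powi n) *\<^sub>R w p) \<partial>m)"
  proof (rule Bochner_Integration.integral_cong)
    fix p assume "p \<in> space m"
    then have "p powi n = qRe (p powi n) *\<^sub>R 1 + inner i (p powi n) *\<^sub>R i"
      using powi_decompose[OF i, of p n] by (simp add: sp scaleR_conv_of_real)
    then have "p powi n * w p = (qRe (p powi n) *\<^sub>R 1 + inner i (p powi n) *\<^sub>R i) * w p"
      by (rule arg_cong)
    then show "p powi n * w p = qRe (p powi n) *\<^sub>R w p + i * (inner i (p powi n) *\<^sub>R w p)"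
      by (simp add: distrib_right)
  qed simp
  also have "\<dots> = (\<integral>p. qRe (p powi n) *\<^sub>R w p \<partial>m) + (\<integral>p. i * (inner i (p powi n) *\<^sub>R w p) \<partial>m)"
    using int by (intro Bochner_Integration.integral_add integrable_mult_right)
  also have "(\<integral>p. i * (inner i (p powi n) *\<^sub>R w p) \<partial>m) = i * (\<integral>p. inner i (p powi n) *\<^sub>R w p \<partial>m)"
    using int(2) by (rule Bochner_Integration.integral_mult_right)
  finally show ?thesis .
qed

lemma powi_minus_circle:
  assumes "i \<in> imag_units" "p \<in> slice_circle i"
  shows "qRe (p powi (- n)) = qRe (p powi n)" "inner i (p powi (- n)) = - inner i (p powi n)"
proof -
  obtain t where t: "\<And>n. qRe (p powi n) = cos (of_int n * t)" "\<And>n. inner i (p powi n) = sin (of_int n * t)"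
    using circle_powi[OF assms] by metis
  show "qRe (p powi (- n)) = qRe (p powi n)" "inner i (p powi (- n)) = - inner i (p powi n)"
    unfolding t by simp_all
qed

text \<open>A moment is C + iS with quaternion-valued cosine and sine integrals C and S. Replacing n
  by -n flips the sign of S only, so the two equations separate C from S; each real component is
  then a problem for a signed measure.\<close>

theorem moments_determine_measure:
  fixes w :: "quat \<Rightarrow> quat"
  assumes i: "i \<in> imag_units" and \<mu>: "quat_measure (circle_borel i) \<mu>"
    and m: "sets m = sets (circle_borel i)" and w: "integrable m w"
    and eq: "\<And>n. moment i \<mu> n = (\<integral>p. p powi n * w p \<partial>m)"
    and A: "A \<in> sets (circle_borel i)"
  shows "\<mu> A = (LINT p:A|m. w p)"
proof (rule euclidean_eqI)
  fix e :: quat assume e: "e \<in> Basis"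
  let ?M = "circle_borel i"
  have sp: "space m = slice_circle i" using sets_eq_imp_space_eq[OF m] by simp
  define P where "P e = jordan_pos ?M (\<lambda>A. inner (\<mu> A) e)" for e
  define N where "N e = jordan_pos ?M (\<lambda>A. - inner (\<mu> A) e)" for e
  have \<mu>e: "signed_measure ?M (\<lambda>A. inner (\<mu> A) e)" for e
    using \<mu> by (intro signed_measure_bounded_linear[OF bounded_linear_inner_left])
      (simp add: signed_measure_def quat_measure_def)
  have P: "finite_measure (P e)" "sets (P e) = sets ?M" "space (P e) = slice_circle i" for e
    unfolding P_def by (simp_all add: finite_measure_jordan_pos[OF \<mu>e])
  have N: "finite_measure (N e)" "sets (N e) = sets ?M" "space (N e) = slice_circle i" for e
    unfolding N_def by (simp_all add: finite_measure_jordan_pos[OF signed_measure_uminus[OF \<mu>e]])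
  define C where "C n e = (\<integral>p. qRe (p powi n) \<partial>P e) - (\<integral>p. qRe (p powi n) \<partial>N e)" for n e
  define S where "S n e = (\<integral>p. inner i (p powi n) \<partial>P e) - (\<integral>p. inner i (p powi n) \<partial>N e)" for n e
  define a b where "a n = (\<integral>p. qRe (p powi n) *\<^sub>R w p \<partial>m)"
    and "b n = (\<integral>p. inner i (p powi n) *\<^sub>R w p \<partial>m)" for n
  have "moment i \<mu> n = (\<Sum>e\<in>Basis. (C n e *\<^sub>R 1 + S n e *\<^sub>R i) * e)" for n
    unfolding moment_def quat_integral_def signed_integral_def P_def[symmetric] N_def[symmetric]
      integral_powi_circle[OF i P(1,2)] integral_powi_circle[OF i N(1,2)]
    by (simp add: C_def S_def scaleR_left_diff_distrib algebra_simps)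
  then have mom: "moment i \<mu> n = (\<Sum>e\<in>Basis. C n e *\<^sub>R e) + i * (\<Sum>e\<in>Basis. S n e *\<^sub>R e)" for n
    by (simp add: distrib_right sum.distrib sum_distrib_left)
  have C_minus: "C (- n) e = C n e" and S_minus: "S (- n) e = - S n e" for n e
  proof -
    have "(\<integral>p. qRe (p powi (- n)) \<partial>Q) = (\<integral>p. qRe (p powi n) \<partial>Q)"
      "(\<integral>p. inner i (p powi (- n)) \<partial>Q) = (\<integral>p. - inner i (p powi n) \<partial>Q)"
      if "space Q = slice_circle i" for Q
      by (rule Bochner_Integration.integral_cong; simp add: that powi_minus_circle[OF i])+
    then show "C (- n) e = C n e" "S (- n) e = - S n e" by (simp_all add: C_def S_def P N)
  qed
  have ab_minus: "a (- n) = a n" "b (- n) = - b n" for n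
    unfolding a_def b_def Bochner_Integration.integral_minus[symmetric]
    by (rule Bochner_Integration.integral_cong; simp add: sp powi_minus_circle[OF i])+
  have eq': "(\<Sum>e\<in>Basis. C n e *\<^sub>R e) + i * (\<Sum>e\<in>Basis. S n e *\<^sub>R e) = a n + i * b n" for n
    using eq[of n] mom[of n] integral_powi_mult_circle[OF i m w, of n] by (simp add: a_def b_def)
  have eq'': "(\<Sum>e\<in>Basis. C n e *\<^sub>R e) - i * (\<Sum>e\<in>Basis. S n e *\<^sub>R e) = a n - i * b n" for n
    using eq'[of "- n"] by (simp add: C_minus S_minus ab_minus sum_negf)
  have "(2::real) *\<^sub>R (\<Sum>e\<in>Basis. C n e *\<^sub>R e) = 2 *\<^sub>R a n" for n
    using arg_cong2[where f = "(+)", OF eq'[of n] eq''[of n]] by (simp add: scaleR_2)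
  then have ca: "(\<Sum>e\<in>Basis. C n e *\<^sub>R e) = a n" for n by simp
  have "i \<noteq> 0" using i by (auto simp: imag_units_def)
  then have sb: "(\<Sum>e\<in>Basis. S n e *\<^sub>R e) = b n" for n using eq'[of n] ca[of n] by simp
  have we: "integrable m (\<lambda>p. inner (w p) e)" using w by simp
  have C: "C n e = (\<integral>p. qRe (p powi n) * inner (w p) e \<partial>m)" for n
  proof -
    have "C n e = inner (a n) e" using e by (simp add: ca[symmetric] inner_sum_left_Basis)
    also have "\<dots> = (\<integral>p. inner (qRe (p powi n) *\<^sub>R w p) e \<partial>m)"
      unfolding a_def using integrable_continuous_mult_circle[OF i m continuous_on_qRe_powi w]
      by (intro integral_inner_left[symmetric])
    finally show ?thesis by simp
  qed
  have S: "S n e = (\<integral>p. inner i (p powi n) * inner (w p) e \<partial>m)" for n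
  proof -
    have "S n e = inner (b n) e" using e by (simp add: sb[symmetric] inner_sum_left_Basis)
    also have "\<dots> = (\<integral>p. inner (inner i (p powi n) *\<^sub>R w p) e \<partial>m)"
      unfolding b_def using integrable_continuous_mult_circle[OF i m continuous_on_inner_powi w]
      by (intro integral_inner_left[symmetric])
    finally show ?thesis by simp
  qed
  have "inner (\<mu> A) e = measure (P e) A - measure (N e) A"
    unfolding P_def N_def by (rule jordan_decomposition[OF \<mu>e A])
  also have "\<dots> = (LINT p:A|m. inner (w p) e)"
    using circle_continuous_determined[OF i P(1,2) N(1,2) m we C[unfolded C_def] S[unfolded S_def]]
    by (rule circle_measure_determined[OF i P(1,2) N(1,2) m we _ A])
  also have "\<dots> = inner (LINT p:A|m. w p) e"
    unfolding set_lebesgue_integral_def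
    using integral_inner_left[OF integrable_mult_indicator[OF A[folded m] w], of e] by simp
  finally show "inner (\<mu> A) e = inner (LINT p:A|m. w p) e" .
qed

section \<open>Fourier series in the Wiener algebra\<close>

lemma sets_arc_measure [simp, measurable_cong]: "sets (arc_measure i) = sets (circle_borel i)"
  by (simp add: arc_measure_def)

lemma space_arc_measure [simp]: "space (arc_measure i) = slice_circle i"
  by (simp add: arc_measure_def)

lemma measurable_cis_in:
  assumes "i \<in> imag_units"
  shows "cis_in i \<in> lborel \<rightarrow>\<^sub>M circle_borel i"
  unfolding circle_borel_def
  by (rule measurable_restrict_space2)
    (auto simp: cis_in_mem[OF assms] intro!: borel_measurable_continuous_onI continuous_on_cis_in)

lemma arc_measure_eq: "arc_measure i = distr (uniform_measure lborel {0..<2 * pi}) (circle_borel i) (cis_in i)"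
  by (simp add: arc_measure_def cis_in_def[abs_def])

lemma uniform_measure_interval:
  "uniform_measure lborel {0..<2 * pi} = density lborel (\<lambda>t. ennreal (indicator {0..<2 * pi} t / (2 * pi)))"
  unfolding uniform_measure_def
  by (intro density_cong) (auto simp: divide_ennreal[symmetric] split: split_indicator)

lemma prob_arc_measure:
  assumes i: "i \<in> imag_units"
  shows "finite_measure (arc_measure i)" "measure (arc_measure i) (slice_circle i) = 1"
proof -
  have *: "emeasure (arc_measure i) (slice_circle i) = 1"
  proof -
    have "cis_in i -` slice_circle i = UNIV" using cis_in_mem[OF i] by auto
    then have "emeasure (arc_measure i) (slice_circle i) = emeasure (uniform_measure lborel {0..<2 * pi}) UNIV"
      unfolding arc_measure_eq using measurable_cis_in[OF i] sets.top[of "circle_borel i"]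
      by (subst emeasure_distr) (auto simp: measurable_def)
    also have "\<dots> = 1" by (simp add: divide_ennreal)
    finally show ?thesis .
  qed
  then show "finite_measure (arc_measure i)" by (intro finite_measureI) simp
  show "measure (arc_measure i) (slice_circle i) = 1" using * by (simp add: measure_def)
qed

lemma integral_powi_arc:
  assumes i: "i \<in> imag_units"
  shows "(\<integral>p. p powi n \<partial>arc_measure i) = (if n = 0 then 1 else 0)"
proof (cases "n = 0")
  case True
  then show ?thesis using prob_arc_measure[OF i] by simp
next
  case False
  have [measurable]: "cis_in i \<in> borel_measurable borel"
    by (intro borel_measurable_continuous_onI continuous_on_cis_in)
  have "(\<lambda>p. p powi n) \<in> borel_measurable (circle_borel i)"
    unfolding circle_borel_def by (intro borel_measurable_continuous_on_restrict continuous_on_powi_circle)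
  moreover have "cis_in i \<in> uniform_measure lborel {0..<2 * pi} \<rightarrow>\<^sub>M circle_borel i"
    using measurable_cis_in[OF i] by (simp add: measurable_def)
  ultimately have "(\<integral>p. p powi n \<partial>arc_measure i) = (\<integral>t. cis_in i (of_int n * t) \<partial>uniform_measure lborel {0..<2 * pi})"
    unfolding arc_measure_eq by (subst integral_distr) (simp_all add: cis_in_powi[OF i])
  also have "\<dots> = (\<integral>t. (indicator {0..<2 * pi} t / (2 * pi)) *\<^sub>R cis_in i (of_int n * t) \<partial>lborel)"
    unfolding uniform_measure_interval by (rule integral_density) (auto simp: divide_simps)
  \<comment> \<open>The fundamental theorem of calculus is applied on a closed interval; the added
    endpoint is a null set.\<close>
  also have "\<dots> = (\<integral>t. (1 / (2 * pi)) *\<^sub>R (indicator {0..2 * pi} t *\<^sub>R cis_in i (of_int n * t)) \<partial>lborel)"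
  proof (rule integral_cong_AE)
    show "AE t in lborel. (indicator {0..<2 * pi} t / (2 * pi)) *\<^sub>R cis_in i (of_int n * t)
        = (1 / (2 * pi)) *\<^sub>R (indicator {0..2 * pi} t *\<^sub>R cis_in i (of_int n * t))"
      using AE_lborel_singleton[of "2 * pi"] by eventually_elim (auto split: split_indicator)
  qed measurable
  also have "\<dots> = 0"
  proof -
    define F where "F t = (sin (of_int n * t) / of_int n) *\<^sub>R 1 + (- cos (of_int n * t) / of_int n) *\<^sub>R i" for t
    have "(\<integral>t. indicator {0..2 * pi} t *\<^sub>R cis_in i (of_int n * t) \<partial>lborel) = F (2 * pi) - F 0"
    proof (rule integral_FTC_Icc)
      fix t
      have d: "((\<lambda>t. sin (of_int n * t) / of_int n) has_field_derivative cos (of_int n * t)) (at t within {0..2 * pi})"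
        "((\<lambda>t. - cos (of_int n * t) / of_int n) has_field_derivative sin (of_int n * t)) (at t within {0..2 * pi})"
        using False by (auto intro!: derivative_eq_intros)
      show "(F has_vector_derivative cis_in i (of_int n * t)) (at t within {0..2 * pi})"
        unfolding F_def cis_in_scaleR
        using has_vector_derivative_add[OF has_vector_derivative_scaleR[OF d(1) has_vector_derivative_const]
            has_vector_derivative_scaleR[OF d(2) has_vector_derivative_const], of 1 i] by simp
    next
      show "continuous_on {0..2 * pi} (\<lambda>t. cis_in i (of_int n * t))"
        unfolding cis_in_def by (intro continuous_intros)
    qed simp
    also have "F (2 * pi) = F 0"
      using sin_int_2pin[of n] cos_int_2pin[of n] by (simp add: F_def mult.commute)
    finally show ?thesis
      unfolding Bochner_Integration.integral_scaleR_right by simp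
  qed
  finally show ?thesis using False by simp
qed

text \<open>Enumerating the integers makes the unordered sum an ordinary series, to which termwise
  integration applies.\<close>

lemma wiener_algebra_suminf:
  fixes a :: "int \<Rightarrow> quat"
  assumes a: "(\<lambda>n. norm (a n)) summable_on UNIV" and p: "norm p = 1"
  shows "(\<Sum>\<^sub>\<infinity>n. p powi n * a n) = (\<Sum>k. p powi int_decode k * a (int_decode k))"
    and "summable (\<lambda>k. norm (p powi int_decode k * a (int_decode k)))"
proof -
  have norm: "norm (p powi n * a n) = norm (a n)" for n
    by (simp add: norm_mult norm_power_int p)
  have "(\<lambda>k. norm (p powi int_decode k * a (int_decode k))) summable_on UNIV"
    using a unfolding norm summable_on_reindex_bij_betw[OF bij_int_decode, of "\<lambda>n. norm (a n)"] .
  then show s: "summable (\<lambda>k. norm (p powi int_decode k * a (int_decode k)))"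
    by (subst (asm) summable_on_UNIV_nonneg_real_iff) simp_all
  have "(\<Sum>\<^sub>\<infinity>n. p powi n * a n) = (\<Sum>\<^sub>\<infinity>k. p powi int_decode k * a (int_decode k))"
    by (rule infsum_reindex_bij_betw[OF bij_int_decode, symmetric])
  also have "\<dots> = (\<Sum>k. p powi int_decode k * a (int_decode k))"
    using norm_summable_imp_has_sum[OF s summable_sums[OF summable_norm_cancel[OF s]]] by (rule infsumI)
  finally show "(\<Sum>\<^sub>\<infinity>n. p powi n * a n) = (\<Sum>k. p powi int_decode k * a (int_decode k))" .
qed

text \<open>Powers integrate to 0 except for exponent 0, and the coefficients, standing on the
  right, can be taken out of the integral. Only the term with exponent -n survives.\<close>

lemma wiener_algebra_moment:
  fixes a :: "int \<Rightarrow> quat"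
  assumes i: "i \<in> imag_units" and a: "(\<lambda>n. norm (a n)) summable_on UNIV"
    and g: "g = (\<lambda>p\<in>sphere 0 1. \<Sum>\<^sub>\<infinity>n. p powi n * a n)"
  shows "integrable (arc_measure i) g" "(\<integral>p. p powi n * g p \<partial>arc_measure i) = a (- n)"
proof -
  let ?m = "arc_measure i"
  interpret finite_measure ?m by (rule prob_arc_measure[OF i])
  have norm1: "norm p = 1" if "p \<in> slice_circle i" for p using that by (simp add: slice_circle_def)
  define f where "f n k p = p powi n * (p powi int_decode k * a (int_decode k))" for n k p
  have norm: "norm (f n k p) = norm (a (int_decode k))" if "p \<in> slice_circle i" for n k p
    by (simp add: f_def norm_mult norm_power_int norm1[OF that])
  have f_int: "integrable ?m (f n k)" for n k
    unfolding f_def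
    by (intro integrable_continuous_circle[OF i prob_arc_measure(1)[OF i]] sets_arc_measure
        continuous_on_mult continuous_on_powi_circle continuous_on_const)
  \<comment> \<open>At the point 1 the terms of the series are the coefficients themselves.\<close>
  have sa: "summable (\<lambda>k. norm (a (int_decode k)))"
    using wiener_algebra_suminf(2)[OF a, of 1] by (simp add: norm_mult norm_power_int)
  have AE_s: "AE p in ?m. summable (\<lambda>k. norm (f n k p))" for n
    using sa by (intro AE_I2) (simp add: norm)
  have "(\<integral>p. norm (f n k p) \<partial>?m) = norm (a (int_decode k))" for n k
  proof -
    have "(\<integral>p. norm (f n k p) \<partial>?m) = (\<integral>p. norm (a (int_decode k)) \<partial>?m)"
      by (rule Bochner_Integration.integral_cong) (auto simp: norm)
    then show ?thesis by (simp add: prob_arc_measure(2)[OF i])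
  qed
  then have int_s: "summable (\<lambda>k. \<integral>p. norm (f n k p) \<partial>?m)" for n using sa by simp
  have sum_f: "p powi n * g p = (\<Sum>k. f n k p)" if "p \<in> slice_circle i" for n p
    unfolding f_def using norm1[OF that] wiener_algebra_suminf[OF a norm1[OF that]]
    by (simp add: g suminf_mult summable_norm_cancel)
  have "integrable ?m (\<lambda>p. \<Sum>k. f 0 k p)"
    by (rule integrable_suminf[OF f_int AE_s int_s])
  then show "integrable ?m g"
    by (rule Bochner_Integration.integrable_cong[THEN iffD1, rotated 2]) (simp_all add: sum_f[symmetric])
  have "(\<integral>p. p powi n * g p \<partial>?m) = (\<integral>p. (\<Sum>k. f n k p) \<partial>?m)"
    by (rule Bochner_Integration.integral_cong) (simp_all add: sum_f)
  also have "\<dots> = (\<Sum>k. \<integral>p. f n k p \<partial>?m)"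
    by (rule integral_suminf[OF f_int AE_s int_s])
  also have "\<dots> = (\<Sum>k. if k = int_encode (- n) then a (int_decode k) else 0)"
  proof (intro arg_cong[where f = suminf] ext)
    fix k
    have "(\<integral>p. f n k p \<partial>?m) = (\<integral>p. p powi (n + int_decode k) * a (int_decode k) \<partial>?m)"
    proof (rule Bochner_Integration.integral_cong)
      fix p assume "p \<in> space ?m"
      then have "p \<noteq> 0" using norm1[of p] by auto
      then show "f n k p = p powi (n + int_decode k) * a (int_decode k)"
        by (simp add: f_def power_int_add mult.assoc)
    qed simp
    also have "\<dots> = (\<integral>p. p powi (n + int_decode k) \<partial>?m) * a (int_decode k)"
      using integrable_continuous_circle[OF i prob_arc_measure(1)[OF i] sets_arc_measure continuous_on_powi_circle]
      by (intro Bochner_Integration.integral_mult_left) blast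
    also have "\<dots> = (if n + int_decode k = 0 then a (int_decode k) else 0)"
      by (simp add: integral_powi_arc[OF i])
    also have "n + int_decode k = 0 \<longleftrightarrow> k = int_encode (- n)"
      by (metis add.right_inverse add_eq_0_iff int_decode_inverse int_encode_inverse)
    finally show "(\<integral>p. f n k p \<partial>?m) = (if k = int_encode (- n) then a (int_decode k) else 0)" .
  qed
  also have "\<dots> = a (int_decode (int_encode (- n)))"
    by (rule sums_unique[symmetric, OF sums_single])
  finally show "(\<integral>p. p powi n * g p \<partial>?m) = a (- n)" by simp
qed

text \<open>The moments on a single circle recover all coefficients, and these determine the
  function on the whole unit sphere.\<close>

lemma wiener_algebra_unique:
  assumes i: "i \<in> imag_units" and g: "g \<in> wiener_algebra" "h \<in> wiener_algebra"
    and eq: "AE p in arc_measure i. g p = h p"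
  shows "g = h"
proof -
  obtain a where a: "(\<lambda>n. norm (a n)) summable_on UNIV" "g = (\<lambda>p\<in>sphere 0 1. \<Sum>\<^sub>\<infinity>n. p powi n * a n)"
    using g(1) by (auto simp: wiener_algebra_def)
  obtain b where b: "(\<lambda>n. norm (b n)) summable_on UNIV" "h = (\<lambda>p\<in>sphere 0 1. \<Sum>\<^sub>\<infinity>n. p powi n * b n)"
    using g(2) by (auto simp: wiener_algebra_def)
  have "a n = b n" for n
  proof -
    have m: "(\<lambda>p. p powi (- n)) \<in> borel_measurable (arc_measure i)"
    proof -
      have "(\<lambda>p. p powi (- n)) \<in> borel_measurable (circle_borel i)"
        unfolding circle_borel_def by (intro borel_measurable_continuous_on_restrict continuous_on_powi_circle)
      then show ?thesis using measurable_cong_sets[OF sets_arc_measure refl] by blast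
    qed
    have "(\<integral>p. p powi (- n) * g p \<partial>arc_measure i) = (\<integral>p. p powi (- n) * h p \<partial>arc_measure i)"
    proof (rule integral_cong_AE)
      show "(\<lambda>p. p powi (- n) * g p) \<in> borel_measurable (arc_measure i)"
        "(\<lambda>p. p powi (- n) * h p) \<in> borel_measurable (arc_measure i)"
        using wiener_algebra_moment(1)[OF i a] wiener_algebra_moment(1)[OF i b]
        by (auto intro!: borel_measurable_times m)
      show "AE p in arc_measure i. p powi (- n) * g p = p powi (- n) * h p"
        using eq by eventually_elim simp
    qed
    then show ?thesis
      using wiener_algebra_moment(2)[OF i a, of "- n"] wiener_algebra_moment(2)[OF i b, of "- n"] by simp
  qed
  then have "a = b" by blast
  then show ?thesis by (simp add: a b)
qed

lemma summable_on_int_symmetric: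
  fixes h :: "int \<Rightarrow> real"
  assumes "\<And>n. 0 \<le> h n" "\<And>n. h (- n) = h n" "summable (\<lambda>n. h (int n))"
  shows "h summable_on UNIV"
proof -
  have s: "(\<lambda>n. h (int n)) summable_on UNIV"
    using assms by (simp add: summable_on_UNIV_nonneg_real_iff)
  have 1: "h summable_on range int"
    using s by (subst summable_on_reindex) (auto simp: o_def)
  have 2: "h summable_on range (\<lambda>n. - int n)"
    using s by (subst summable_on_reindex) (auto simp: o_def assms(2) inj_on_def)
  have "h summable_on (range int \<union> (range (\<lambda>n. - int n) - range int))"
    by (intro summable_on_Un_disjoint 1 summable_on_subset_banach[OF 2]) auto
  moreover have "x \<in> range int \<union> (range (\<lambda>n. - int n) - range int)" for x :: int
    by (cases x rule: int_cases2) auto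
  then have "range int \<union> (range (\<lambda>n. - int n) - range int) = UNIV" by blast
  ultimately show ?thesis by simp
qed

theorem theorem9p2:
  fixes c :: "int \<Rightarrow> quat" and i j :: quat
    and \<mu> :: "quat set \<Rightarrow> quat" and \<gamma> :: "nat \<Rightarrow> quat"
  assumes "nontrivial_positive_definite_seq c" and "c 0 = 1"
    and "i \<in> imag_units" and "j \<in> imag_units" and "orthogonal i j"
    and "q_positive i j \<mu>" and "\<And>n. c n = moment i \<mu> n"
    and "verblunsky_coeffs c \<gamma>"
    and "summable (\<lambda>n. norm (\<gamma> n))"
  shows "abs_continuous i \<mu> \<and>
    (\<forall>w. is_RN_derivative i \<mu> w \<longrightarrow>
       (\<exists>!g. g \<in> wiener_algebra \<and> (AE p in arc_measure i. g p = w p)))"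
proof -
  note i = assms(3)
  define a where "a n = c (- n)" for n
  have herm: "c (- n) = qcnj (c n)" for n
    using positive_definite_hermitian assms(1,2) by (auto simp: nontrivial_positive_definite_seq_def)
  have "summable (\<lambda>n. norm (c (- int n)))"
    by (rule verblunsky_summable_imp_moments_summable[OF assms(1,2,8,9)])
  \<comment> \<open>The Schur algorithm controls only one half of the moments; Hermitian symmetry
    gives the other half the same norms.\<close>
  then have a: "(\<lambda>n. norm (a n)) summable_on UNIV"
    by (intro summable_on_int_symmetric) (simp_all add: a_def herm)
  define g where "g = (\<lambda>p\<in>sphere 0 1. \<Sum>\<^sub>\<infinity>n. p powi n * a n)"
  have gW: "g \<in> wiener_algebra" using a by (auto simp: wiener_algebra_def g_def)
  note g = wiener_algebra_moment[OF i a g_def]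
  have \<mu>: "quat_measure (circle_borel i) \<mu>" using assms(6) by (simp add: q_positive_def)
  have "moment i \<mu> n = (\<integral>p. p powi n * g p \<partial>arc_measure i)" for n
    by (simp add: g(2) a_def assms(7))
  then have RN: "is_RN_derivative i \<mu> g"
    using moments_determine_measure[OF i \<mu> sets_arc_measure g(1)] g(1) by (simp add: is_RN_derivative_def)
  have "\<exists>!h. h \<in> wiener_algebra \<and> (AE p in arc_measure i. h p = w p)" if w: "is_RN_derivative i \<mu> w" for w
  proof -
    interpret finite_measure "arc_measure i" by (rule prob_arc_measure[OF i])
    have gw: "AE p in arc_measure i. g p = w p"
      using RN w by (intro density_unique_banach) (auto simp: is_RN_derivative_def)
    show ?thesis
    proof (rule ex1I[of _ g])
      show "g \<in> wiener_algebra \<and> (AE p in arc_measure i. g p = w p)" using gW gw by simp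
      fix h assume h: "h \<in> wiener_algebra \<and> (AE p in arc_measure i. h p = w p)"
      then have "AE p in arc_measure i. h p = w p" by simp
      with gw have "AE p in arc_measure i. h p = g p" by eventually_elim simp
      then show "h = g" using h gW by (intro wiener_algebra_unique[OF i]) auto
    qed
  qed
  then show ?thesis using RN by (auto simp: abs_continuous_def)
qed

end
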